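(* Let $n,k$ be positive integers, let $r$ be a non-negative integer with $r<n$, let $\rho=(\rho_1,\dots,\rho_k)$ be integers with $1\le \rho_\ell\le n\le k$ for all $\ell\in[k]$ and $\sum_{\ell\in[k]}\rho_\ell=n^2$, and let $d=(d_1,\dots,d_k)$ be non-negative integers with $\sum_{\ell\in[k]}d_\ell\le n-r$. Let $L$ be an $r\times r$ symmetric $\rho$-latin rectangle, and let $e_\ell$ be the number of occurrences of $\ell$ in $L$ for $\ell\in[k]$. Then $L$ can be completed to an $n\times n$ symmetric $\rho$-latin square with prescribed diagonal tail $d$ if and only if $L$ is $(\rho,d)$-admissible and both of the following conditions hold: $$(n-r)|I|\le\sum_{\ell\in[k]}\min\left\{\left\lfloor\frac{\rho_\ell-e_\ell-d_\ell}{2}\right\rfloor,\ \mu_I(\ell)\right\}\qquad\text{for all } I\subseteq[r],$$ $$\sum_{\ell\in K}\max\{0,\ \rho_\ell-e_\ell+r-n\}\le\sum_{i\in[r]}\min\{n-r,\ \mu_K(i)\}\qquad\text{for all } K\subseteq[k].$$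
   Context: $[m]=\{1,\dots,m\}$. An $r\times r$ $\rho$-latin rectangle is an $r\times r$ array, every cell of which is filled with a symbol from $[k]$, such that each symbol occurs at most once in each row and at most once in each column, and each symbol $\ell\in[k]$ occurs at most $\rho_\ell$ times in the array. An $n\times n$ $\rho$-latin square is an $n\times n$ array, every cell filled with a symbol from $[k]$, such that each symbol occurs at most once in each row and at most once in each column, and each symbol $\ell\in[k]$ occurs exactly $\rho_\ell$ times. An array $A$ is symmetric if $A_{ij}=A_{ji}$ for all $i,j$. $L$ can be completed (extended, embedded) to an $n\times n$ array $L'$ means that $L$ is the top left $r\times r$ subarray of $L'$. $L'$ has prescribed diagonal tail $d$ means that each symbol $\ell\in[k]$ occurs at least $d_\ell$ times among the entries $L'_{ii}$, $r+1\le i\le n$. For $I\subseteq[r]$ and $\ell\in[k]$, $\mu_I(\ell)$ is the number of rows $i\in I$ of $L$ in which symbol $\ell$ does not occur. For $K\subseteq[k]$ and $i\in[r]$, $\mu_K(i)$ is the number of symbols in $K$ that do not occur in row $i$ of $L$. $L$ is $(\rho,d)$-admissible if all of the following hold: (1) $\rho_\ell-e_\ell+d_\ell\le 2(n-r)$ for all $\ell\in[k]$; (2) $|\{\ell\in[k]:\rho_\ell-e_\ell\not\equiv d_\ell \pmod 2\}|\le n-r-\sum_{\ell\in[k]}d_\ell$; (3) $n-r-\sum_{\ell\in[k]}d_\ell\equiv\sum_{\ell\in[k]}(\rho_\ell-e_\ell-d_\ell)\equiv|\{\ell\in[k]:\rho_\ell-e_\ell\not\equiv d_\ell\pmod 2\}|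 \pmod 2$. *)

theory Defs
  imports "HOL-Number_Theory.Cong"
begin

(* An m x m array is a function A :: nat => nat => nat of which only the entries A i j with
   i, j in {1..m} matter; the symbols are the elements of {1..k}.  The families rho and d are
   likewise relevant only on {1..k}. *)

definition occurrences :: "nat \<Rightarrow> (nat \<Rightarrow> nat \<Rightarrow> nat) \<Rightarrow> nat \<Rightarrow> nat" where
  "occurrences m A l = card {(i, j) \<in> {1..m} \<times> {1..m}. A i j = l}"

definition latin_array :: "nat \<Rightarrow> nat \<Rightarrow> (nat \<Rightarrow> nat \<Rightarrow> nat) \<Rightarrow> bool" where
  "latin_array k m A \<longleftrightarrow>
     (\<forall>i\<in>{1..m}. \<forall>j\<in>{1..m}. A i j \<in> {1..k}) \<and>
     (\<forall>l\<in>{1..k}. \<forall>i\<in>{1..m}. card {j \<in> {1..m}. A i j = l} \<le> 1) \<and>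
     (\<forall>l\<in>{1..k}. \<forall>j\<in>{1..m}. card {i \<in> {1..m}. A i j = l} \<le> 1)"

definition rho_latin_rectangle ::
    "nat \<Rightarrow> (nat \<Rightarrow> nat) \<Rightarrow> nat \<Rightarrow> (nat \<Rightarrow> nat \<Rightarrow> nat) \<Rightarrow> bool" where
  "rho_latin_rectangle k \<rho> r A \<longleftrightarrow>
     latin_array k r A \<and> (\<forall>l\<in>{1..k}. occurrences r A l \<le> \<rho> l)"

definition rho_latin_square ::
    "nat \<Rightarrow> (nat \<Rightarrow> nat) \<Rightarrow> nat \<Rightarrow> (nat \<Rightarrow> nat \<Rightarrow> nat) \<Rightarrow> bool" where
  "rho_latin_square k \<rho> n A \<longleftrightarrow>
     latin_array k n A \<and> (\<forall>l\<in>{1..k}. occurrences n A l = \<rho> l)"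

definition symmetric_array :: "nat \<Rightarrow> (nat \<Rightarrow> nat \<Rightarrow> nat) \<Rightarrow> bool" where
  "symmetric_array m A \<longleftrightarrow> (\<forall>i\<in>{1..m}. \<forall>j\<in>{1..m}. A i j = A j i)"

definition top_left_subarray ::
    "nat \<Rightarrow> (nat \<Rightarrow> nat \<Rightarrow> nat) \<Rightarrow> (nat \<Rightarrow> nat \<Rightarrow> nat) \<Rightarrow> bool" where
  "top_left_subarray r L L' \<longleftrightarrow> (\<forall>i\<in>{1..r}. \<forall>j\<in>{1..r}. L' i j = L i j)"

definition has_diagonal_tail ::
    "nat \<Rightarrow> nat \<Rightarrow> nat \<Rightarrow> (nat \<Rightarrow> nat) \<Rightarrow> (nat \<Rightarrow> nat \<Rightarrow> nat) \<Rightarrow> bool" where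
  "has_diagonal_tail k r n d L' \<longleftrightarrow>
     (\<forall>l\<in>{1..k}. d l \<le> card {i \<in> {r+1..n}. L' i i = l})"

definition mu_rows :: "nat \<Rightarrow> (nat \<Rightarrow> nat \<Rightarrow> nat) \<Rightarrow> nat set \<Rightarrow> nat \<Rightarrow> nat" where
  "mu_rows r L I l = card {i \<in> I. \<forall>j\<in>{1..r}. L i j \<noteq> l}"

definition mu_symbols :: "nat \<Rightarrow> (nat \<Rightarrow> nat \<Rightarrow> nat) \<Rightarrow> nat set \<Rightarrow> nat \<Rightarrow> nat" where
  "mu_symbols r L K i = card {l \<in> K. \<forall>j\<in>{1..r}. L i j \<noteq> l}"

(* Differences are taken in int, since they may be negative; accordingly x div 2 on int is the
   floor of x / 2 also for negative x. *)

definition odd_discrepancy ::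
    "nat \<Rightarrow> (nat \<Rightarrow> nat) \<Rightarrow> (nat \<Rightarrow> nat) \<Rightarrow> nat \<Rightarrow> (nat \<Rightarrow> nat \<Rightarrow> nat) \<Rightarrow> nat set" where
  "odd_discrepancy k \<rho> d r L =
     {l \<in> {1..k}. \<not> [int (\<rho> l) - int (occurrences r L l) = int (d l)] (mod 2)}"

definition admissible ::
    "nat \<Rightarrow> (nat \<Rightarrow> nat) \<Rightarrow> (nat \<Rightarrow> nat) \<Rightarrow> nat \<Rightarrow> nat \<Rightarrow> (nat \<Rightarrow> nat \<Rightarrow> nat) \<Rightarrow> bool" where
  "admissible k \<rho> d r n L \<longleftrightarrow>
     (\<forall>l\<in>{1..k}. int (\<rho> l) - int (occurrences r L l) + int (d l) \<le> 2 * (int n - int r)) \<and>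
     int (card (odd_discrepancy k \<rho> d r L)) \<le> int n - int r - (\<Sum>l\<in>{1..k}. int (d l)) \<and>
     [int n - int r - (\<Sum>l\<in>{1..k}. int (d l))
        = (\<Sum>l\<in>{1..k}. int (\<rho> l) - int (occurrences r L l) - int (d l))] (mod 2) \<and>
     [(\<Sum>l\<in>{1..k}. int (\<rho> l) - int (occurrences r L l) - int (d l))
        = int (card (odd_discrepancy k \<rho> d r L))] (mod 2)"

end

theory Submission
  imports Defs Complex_Main
begin

text \<open>Regard a symmetric array as an edge colouring of a complete graph with a loop at every vertex, the
  symbols being the colours. Gluing the rows r+1, ..., n to a single vertex leaves an outline: for every
  row of L a set of n - r missing symbols, and for every symbol the number of its cells on
  and above the diagonal of the new block. Conversely every outline in which no symbol is too frequent can
  be unfolded, one row at a time, by rounding the row that receives an equal share of everything. Outlines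
  extending L correspond to degree-constrained subgraphs of the bipartite graph in which a row is
  joined to the symbols that it misses, and the two inequalities are the cut conditions for such a
  subgraph.\<close>

section \<open>Matchings in bipartite graphs\<close>

text \<open>Put m = n - r and let a = \<rho> - e be the number of cells of a symbol outside L. In a
  completion a = 2x + y, with x cells to the right of L and y cells in the new m by m block. Each
  new column contains the symbol at most once, so x + y \<le> m, that is, x \<ge> a - m; and y \<ge>
  d, that is, x \<le> floor((a - d) / 2). These bounds are the max and the min of the two
  inequalities; the first condition of \<open>admissible\<close> says that a - m does not exceed the
  floor. Parity enters only after x is chosen. Off-diagonal cells of the new block come in mirror
  pairs, so the number of diagonal cells of a symbol is d, plus 1 if a - d is odd, plus an even
  number. The other conditions of \<open>admissible\<close> say that m diagonal cells can be reached
  in this way. The obstacle in the unfolding is that a new row must fill all its cells and also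
  contain every symbol that would otherwise become too frequent. This calls for a form of Hall's
  theorem that saturates one side and a prescribed part of the other.\<close>

theorem hall_marriage:
  fixes N :: "'a \<Rightarrow> 'b set"
  assumes "finite X" and "\<And>x. x \<in> X \<Longrightarrow> finite (N x)"
    and "\<And>A. A \<subseteq> X \<Longrightarrow> card A \<le> card (\<Union>(N ` A))"
  obtains f where "inj_on f X" and "\<And>x. x \<in> X \<Longrightarrow> f x \<in> N x"
proof -
  from assms have "\<exists>f. inj_on f X \<and> (\<forall>x\<in>X. f x \<in> N x)"
  proof (induction X arbitrary: N rule: finite_psubset_induct)
    case (psubset X)
    show ?case
    \<comment> \<open>Either some proper nonempty \<open>A\<close> is critical, and \<open>A\<close>
      and \<open>X - A\<close> can be matched separately, or every such set has a surplus, and any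
      single edge can be fixed.\<close>
    proof (cases "\<exists>A. A \<subset> X \<and> A \<noteq> {} \<and> card (\<Union>(N ` A)) = card A")
      case True
      then obtain A where A: "A \<subset> X" "A \<noteq> {}" "card (\<Union>(N ` A)) = card A"
        by blast
      define U where "U = \<Union>(N ` A)"
      have finA: "finite A" using A(1) psubset.hyps finite_subset by blast
      have finU: "finite U" unfolding U_def using finA A(1) psubset.prems(1) by blast
      have "\<exists>f. inj_on f A \<and> (\<forall>x\<in>A. f x \<in> N x)"
        by (rule psubset.IH[OF A(1)]) (use A(1) psubset.prems in auto)
      then obtain f where f: "inj_on f A" "\<And>x. x \<in> A \<Longrightarrow> f x \<in> N x" by blast
      have "\<exists>g. inj_on g (X - A) \<and> (\<forall>x\<in>X - A. g x \<in> N x - U)"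
      proof (rule psubset.IH)
        show "X - A \<subset> X" using A by blast
        show "finite (N x - U)" if "x \<in> X - A" for x using that psubset.prems(1) by blast
        show "card B \<le> card (\<Union>((\<lambda>x. N x - U) ` B))" if "B \<subseteq> X - A" for B
        proof -
          have finB: "finite B" using that psubset.hyps by (meson Diff_subset finite_subset)
          have "finite (\<Union>(N ` B))" using finB that psubset.prems(1) by blast
          \<comment> \<open>\<open>U\<close> has exactly \<open>card A\<close> elements, so deleting
            it takes away no more than \<open>A\<close> adds to \<open>B \<union> A\<close>.\<close>
          have "card (B \<union> A) \<le> card (\<Union>(N ` (B \<union> A)))"
            using that A(1) by (intro psubset.prems(2)) blast
          also have "\<Union>(N ` (B \<union> A)) = (\<Union>((\<lambda>x. N x - U) ` B)) \<union> U"
            unfolding U_def by blast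
          also have "card \<dots> = card (\<Union>((\<lambda>x. N x - U) ` B)) + card U"
            using finU \<open>finite (\<Union>(N ` B))\<close>
            by (intro card_Un_disjoint) (auto intro: finite_subset[of _ "\<Union>(N ` B)"])
          finally show ?thesis
            using A(3) finA finB that unfolding U_def[symmetric]
            by (subst (asm) card_Un_disjoint) auto
        qed
      qed
      then obtain g where g: "inj_on g (X - A)" "\<And>x. x \<in> X - A \<Longrightarrow> g x \<in> N x - U" by blast
      have "f x \<noteq> g y" if "x \<in> A" "y \<in> X - A" for x y
        using f(2)[OF that(1)] g(2)[OF that(2)] that(1) by (auto simp: U_def)
      then have "inj_on (\<lambda>x. if x \<in> A then f x else g x) X"
        using f(1) g(1) unfolding inj_on_def by (metis DiffI)
      then show ?thesis using f(2) g(2)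
        by (intro exI[of _ "\<lambda>x. if x \<in> A then f x else g x"]) auto
    next
      case False
      show ?thesis
      proof (cases "X = {}")
        case True then show ?thesis by simp
      next
        case nonempty: False
        then obtain x where x: "x \<in> X" by blast
        have "card {x} \<le> card (N x)" using psubset.prems(2)[of "{x}"] x by simp
        then obtain y where y: "y \<in> N x" by fastforce
        have "\<exists>g. inj_on g (X - {x}) \<and> (\<forall>z\<in>X - {x}. g z \<in> N z - {y})"
        proof (rule psubset.IH)
          show "X - {x} \<subset> X" using x by blast
          show "finite (N z - {y})" if "z \<in> X - {x}" for z using that psubset.prems(1) by blast
          show "card B \<le> card (\<Union>((\<lambda>z. N z - {y}) ` B))" if B: "B \<subseteq> X - {x}" for B
          proof (cases "B = {}")
            case False
            \<comment> \<open>\<open>B\<close> omits \<open>x\<close>, hence is proper and not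
              critical; its surplus pays for the loss of \<open>y\<close>.\<close>
            have "card B \<noteq> card (\<Union>(N ` B))" "card B \<le> card (\<Union>(N ` B))"
              using \<open>\<not> (\<exists>A. _ A)\<close> False B x psubset.prems(2)
              by (metis DiffE insertCI psubsetI subset_Diff_insert subset_eq)
                (meson B Diff_subset order.trans psubset.prems(2))
            moreover have "card (\<Union>(N ` B) - {y}) \<ge> card (\<Union>(N ` B)) - 1"
              by (simp add: diff_card_le_card_Diff[where B = "{y}", simplified])
            moreover have "\<Union>((\<lambda>z. N z - {y}) ` B) = \<Union>(N ` B) - {y}" by blast
            ultimately show ?thesis by simp
          qed simp
        qed
        then obtain g where g: "inj_on g (X - {x})" "\<And>z. z \<in> X - {x} \<Longrightarrow> g z \<in> N z - {y}"
          by blast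
        have "inj_on (g(x := y)) X"
          using g by (auto simp: inj_on_def)
        moreover have "\<forall>z\<in>X. (g(x := y)) z \<in> N z" using g(2) y by auto
        ultimately show ?thesis by blast
      qed
    qed
  qed
  then show thesis using that by blast
qed

text \<open>Combining the two one-sided matchings is the decomposition from Banach's proof of the
  Schroeder--Bernstein theorem.\<close>

lemma hall_two_sided:
  fixes E :: "('a \<times> 'b) set"
  assumes "finite X" "finite Y" "E \<subseteq> X \<times> Y" "Y0 \<subseteq> Y"
    and X: "\<And>A. A \<subseteq> X \<Longrightarrow> card A \<le> card (E `` A)"
    and Y: "\<And>B. B \<subseteq> Y0 \<Longrightarrow> card B \<le> card (E\<inverse> `` B)"
  obtains h where "inj_on h X" "\<And>x. x \<in> X \<Longrightarrow> (x, h x) \<in> E" "Y0 \<subseteq> h ` X"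
proof -
  have finE: "finite E" using assms(1-3) finite_subset by blast
  obtain f where f: "inj_on f X" "\<And>x. x \<in> X \<Longrightarrow> f x \<in> E `` {x}"
  proof (rule hall_marriage[of X "\<lambda>x. E `` {x}"])
    show "card A \<le> card (\<Union>x\<in>A. E `` {x})" if "A \<subseteq> X" for A
      using X[OF that] by (simp add: Image_eq_UN[symmetric])
  qed (use assms(1) finE in \<open>auto simp: finite_Image\<close>)
  obtain g where g: "inj_on g Y0" "\<And>y. y \<in> Y0 \<Longrightarrow> g y \<in> E\<inverse> `` {y}"
  proof (rule hall_marriage[of Y0 "\<lambda>y. E\<inverse> `` {y}"])
    show "card B \<le> card (\<Union>y\<in>B. E\<inverse> `` {y})" if "B \<subseteq> Y0" for B
      using Y[OF that] by (simp add: Image_eq_UN[symmetric])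
  qed (use assms(2,4) finE in \<open>auto simp: finite_Image intro: finite_subset\<close>)
  have mono: "mono (\<lambda>S. X - g ` (Y0 - f ` S))"
    by (intro monoI Diff_mono image_mono subset_refl)
  \<comment> \<open>Points of \<open>S\<close> keep \<open>f\<close>, the others switch to the
    inverse of \<open>g\<close>. By the fixed point equation the others are exactly the
    \<open>g\<close>-partners of the elements of \<open>Y0\<close> that \<open>f\<close> does not
    reach from \<open>S\<close>, so the switch covers these and collides with nothing.\<close>
  obtain S where S: "S = X - g ` (Y0 - f ` S)" by (rule that[OF lfp_unfold[OF mono]])
  have gX: "g ` Y0 \<subseteq> X" using g(2) assms(3) by blast
  define h where "h = (\<lambda>x. if x \<in> S then f x else inv_into Y0 g x)"
  have rest: "X - S = g ` (Y0 - f ` S)" using S gX by blast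
  have inv: "inv_into Y0 g x \<in> Y0 - f ` S \<and> g (inv_into Y0 g x) = x" if x: "x \<in> X - S" for x
  proof -
    obtain y where "y \<in> Y0 - f ` S" "x = g y" using x unfolding rest by blast
    then show ?thesis using inv_into_f_f[OF g(1), of y] by simp
  qed
  have hS: "h x \<in> f ` S \<longleftrightarrow> x \<in> S" if "x \<in> X" for x
    using inv[of x] that by (simp add: h_def)
  have "inj_on h X"
  proof (rule inj_onI)
    fix x x' assume x: "x \<in> X" "x' \<in> X" "h x = h x'"
    then have same: "x \<in> S \<longleftrightarrow> x' \<in> S" using hS by metis
    show "x = x'"
    proof (cases "x \<in> S")
      case True
      then have "f x = f x'" using same x(3) by (simp add: h_def)
      then show ?thesis using f(1) x(1,2) by (simp add: inj_on_def)
    next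
      case False
      then have "inv_into Y0 g x = inv_into Y0 g x'" using same x(3) by (simp add: h_def)
      then show ?thesis using False same x(1,2) inv by (metis DiffI)
    qed
  qed
  moreover have "(x, h x) \<in> E" if "x \<in> X" for x
  proof (cases "x \<in> S")
    case True then show ?thesis using f(2)[OF that] by (simp add: h_def)
  next
    case False
    then show ?thesis using inv[of x] g(2)[of "inv_into Y0 g x"] that by (auto simp: h_def)
  qed
  moreover have "Y0 \<subseteq> h ` X"
  proof
    fix y assume y: "y \<in> Y0"
    show "y \<in> h ` X"
    proof (cases "y \<in> f ` S")
      case True then show ?thesis using S unfolding h_def by auto
    next
      case False
      then have "g y \<in> X - S" using y rest by blast
      moreover have "h (g y) = y" using calculation g(1) y by (simp add: h_def)
      ultimately show ?thesis by (metis DiffD1 image_eqI)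
    qed
  qed
  ultimately show thesis using that by blast
qed

text \<open>Divided by \<open>c\<close>, the weights form a fractional matching, which is rounded
  here inside its support. Counting weight gives both Hall conditions: a set of rows carries
  \<open>c\<close> per row, and its neighbours hold at most \<open>c\<close> each; for tight columns
  the roles are exchanged.\<close>

lemma matching_of_weights:
  fixes w :: "'a \<Rightarrow> 'b \<Rightarrow> real"
  assumes fin: "finite X" "finite Y" and "c > 0" and pos: "\<And>x y. w x y \<ge> 0"
    and row: "\<And>x. x \<in> X \<Longrightarrow> (\<Sum>y\<in>Y. w x y) = c"
    and col: "\<And>y. y \<in> Y \<Longrightarrow> (\<Sum>x\<in>X. w x y) \<le> c"
  obtains h where "inj_on h X" "\<And>x. x \<in> X \<Longrightarrow> h x \<in> Y \<and> w x (h x) > 0"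
    "\<And>y. y \<in> Y \<Longrightarrow> (\<Sum>x\<in>X. w x y) = c \<Longrightarrow> y \<in> h ` X"
proof -
  define E where "E = {(x, y) \<in> X \<times> Y. w x y > 0}"
  define Y0 where "Y0 = {y \<in> Y. (\<Sum>x\<in>X. w x y) = c}"
  have nz: "w x y = 0" if "x \<in> X" "y \<in> Y" "(x, y) \<notin> E" for x y
    using that pos[of x y] by (auto simp: E_def)
  obtain h where h: "inj_on h X" "\<And>x. x \<in> X \<Longrightarrow> (x, h x) \<in> E" "Y0 \<subseteq> h ` X"
  proof (rule hall_two_sided[of X Y E Y0])
    show "card A \<le> card (E `` A)" if A: "A \<subseteq> X" for A
    proof -
      have sub: "E `` A \<subseteq> Y" by (auto simp: E_def)
      have "c * card A = (\<Sum>x\<in>A. \<Sum>y\<in>Y. w x y)" using A row by (simp add: subset_iff)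
      also have "\<dots> = (\<Sum>x\<in>A. \<Sum>y\<in>E `` A. w x y)"
        using A sub fin by (intro sum.cong refl sum.mono_neutral_right) (auto intro!: nz)
      also have "\<dots> = (\<Sum>y\<in>E `` A. \<Sum>x\<in>A. w x y)" by (rule sum.swap)
      also have "\<dots> \<le> (\<Sum>y\<in>E `` A. \<Sum>x\<in>X. w x y)"
        using A fin pos by (intro sum_mono sum_mono2) auto
      also have "\<dots> \<le> (\<Sum>y\<in>E `` A. c)" using sub col by (intro sum_mono) auto
      finally show ?thesis using \<open>c > 0\<close> by (simp add: mult.commute)
    qed
    show "card B \<le> card (E\<inverse> `` B)" if B: "B \<subseteq> Y0" for B
    proof -
      have sub: "E\<inverse> `` B \<subseteq> X" "B \<subseteq> Y" using B by (auto simp: E_def Y0_def)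
      have "c * card B = (\<Sum>y\<in>B. \<Sum>x\<in>X. w x y)" using B by (simp add: subset_iff Y0_def)
      also have "\<dots> = (\<Sum>y\<in>B. \<Sum>x\<in>E\<inverse> `` B. w x y)"
        using sub fin by (intro sum.cong refl sum.mono_neutral_right) (auto intro!: nz)
      also have "\<dots> = (\<Sum>x\<in>E\<inverse> `` B. \<Sum>y\<in>B. w x y)" by (rule sum.swap)
      also have "\<dots> \<le> (\<Sum>x\<in>E\<inverse> `` B. \<Sum>y\<in>Y. w x y)"
        using sub fin pos by (intro sum_mono sum_mono2) auto
      also have "\<dots> = (\<Sum>x\<in>E\<inverse> `` B. c)" using sub row by (intro sum.cong) auto
      finally show ?thesis using \<open>c > 0\<close> by (simp add: mult.commute)
    qed
  qed (use fin in \<open>auto simp: E_def Y0_def\<close>)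
  show thesis
    by (rule that[OF h(1)]) (use h(2,3) in \<open>auto simp: E_def Y0_def\<close>)
qed

section \<open>Degree-constrained subgraphs\<close>

lemma card_edges_between:
  assumes "finite I" "finite K"
  shows "card (E \<inter> I \<times> K) = (\<Sum>i\<in>I. card {l \<in> K. (i, l) \<in> E})"
    and "card (E \<inter> I \<times> K) = (\<Sum>l\<in>K. card {i \<in> I. (i, l) \<in> E})"
proof -
  have "E \<inter> I \<times> K = Sigma I (\<lambda>i. {l \<in> K. (i, l) \<in> E})" by auto
  then show *: "card (E \<inter> I \<times> K) = (\<Sum>i\<in>I. card {l \<in> K. (i, l) \<in> E})"
    using assms by (simp add: card_SigmaI)
  show "card (E \<inter> I \<times> K) = (\<Sum>l\<in>K. card {i \<in> I. (i, l) \<in> E})"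
    unfolding * by (rule sum_multicount_gen) (use assms in auto)
qed

text \<open>Every edge is either rejected, using up one of the slots of its row that have to stay out of the
  factor, or accepted, using up one of the g l slots of its column; the rejection slots and the
  first f l acceptance slots have to be used.\<close>

lemma bipartite_degree_factor:
  fixes E :: "('a \<times> 'b) set" and b :: "'a \<Rightarrow> nat" and f g :: "'b \<Rightarrow> nat"
  assumes fin: "finite R" "finite Y" and E: "E \<subseteq> R \<times> Y"
    and fg: "\<And>l. l \<in> Y \<Longrightarrow> f l \<le> g l"
    and rows: "\<And>I. I \<subseteq> R \<Longrightarrow> (\<Sum>i\<in>I. b i) \<le> (\<Sum>l\<in>Y. min (g l) (card {i \<in> I. (i, l) \<in> E}))"
    and cols: "\<And>K. K \<subseteq> Y \<Longrightarrow> (\<Sum>l\<in>K. f l) \<le> (\<Sum>i\<in>R. min (b i) (card {l \<in> K. (i, l) \<in> E}))"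
  obtains F where "F \<subseteq> E" "\<And>i. i \<in> R \<Longrightarrow> card {l. (i, l) \<in> F} = b i"
    "\<And>l. l \<in> Y \<Longrightarrow> f l \<le> card {i. (i, l) \<in> F} \<and> card {i. (i, l) \<in> F} \<le> g l"
proof -
  define \<mu> where "\<mu> = (\<lambda>i. card {l \<in> Y. (i, l) \<in> E})"
  have finE: "finite E" using fin E finite_subset by blast
  \<comment> \<open>The row condition for a singleton; it makes the truncated difference
    \<open>\<mu> i - b i\<close> exact.\<close>
  have b_le: "b i \<le> \<mu> i" if "i \<in> R" for i
  proof -
    have "b i \<le> (\<Sum>l\<in>Y. card {i' \<in> {i}. (i', l) \<in> E})"
      using rows[of "{i}"] that by (auto elim!: order.trans intro!: sum_mono)
    also have "\<dots> = \<mu> i"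
      using card_edges_between[of "{i}" Y E] fin by (simp add: \<mu>_def)
    finally show ?thesis .
  qed
  \<comment> \<open>\<open>Inl (i, c)\<close> is a rejection slot of row \<open>i\<close>, and
    \<open>Inr (l, c)\<close> an acceptance slot of column \<open>l\<close>. With \<open>g\<close>
    these are all slots, with \<open>f\<close> those that have to be used.\<close>
  define S where "S = (\<lambda>(I :: 'a set) (K :: 'b set) g. Sigma I (\<lambda>i. {..<\<mu> i - b i})
      <+> Sigma K (\<lambda>l. {..<g l :: nat}))"
  have card_S: "card (S I K g') + (\<Sum>i\<in>I. b i) = card (E \<inter> I \<times> Y) + (\<Sum>l\<in>K. g' l)"
    and fin_S: "finite (S I K g')" if "I \<subseteq> R" "K \<subseteq> Y" for I K g'
  proof -
    have finIK: "finite I" "finite K" using that fin finite_subset by blast+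
    then show "finite (S I K g')" by (auto simp: S_def)
    have "(\<Sum>i\<in>I. \<mu> i - b i) + (\<Sum>i\<in>I. b i) = (\<Sum>i\<in>I. \<mu> i)"
      using that b_le by (simp add: sum.distrib[symmetric] subset_iff)
    then show "card (S I K g') + (\<Sum>i\<in>I. b i) = card (E \<inter> I \<times> Y) + (\<Sum>l\<in>K. g' l)"
      using finIK fin by (simp add: S_def card_Plus card_SigmaI card_edges_between(1) \<mu>_def)
  qed
  define H where "H = {(e, z) \<in> E \<times> S R Y g. case z of Inl p \<Rightarrow> fst p = fst e | Inr p \<Rightarrow> fst p = snd e}"
  obtain h where h: "inj_on h E" "\<And>e. e \<in> E \<Longrightarrow> (e, h e) \<in> H" "S R Y f \<subseteq> h ` E"
  proof (rule hall_two_sided[of E "S R Y g" H "S R Y f"])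
    show "S R Y f \<subseteq> S R Y g" using fg by (force simp: S_def)
    show "card A \<le> card (H `` A)" if A: "A \<subseteq> E" for A
    proof -
      define I K where "I = fst ` A" and "K = snd ` A"
      have sub: "I \<subseteq> R" "K \<subseteq> Y" using A E by (auto simp: I_def K_def)
      have finIK: "finite I" "finite K" using sub fin finite_subset by blast+
      have HA: "S I K g \<subseteq> H `` A"
      proof
        fix z assume z: "z \<in> S I K g"
        then consider p where "z = Inl p" "fst p \<in> I" | p where "z = Inr p" "fst p \<in> K"
          by (auto simp: S_def)
        then obtain e where "e \<in> A" "case z of Inl p \<Rightarrow> fst p = fst e | Inr p \<Rightarrow> fst p = snd e"
          by cases (auto simp: I_def K_def)
        moreover have "z \<in> S R Y g" using z sub by (auto simp: S_def)
        ultimately show "z \<in> H `` A" using A by (auto simp: H_def)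
      qed
      have "finite (H `` A)" by (rule finite_subset[OF _ fin_S[of R Y g]]) (auto simp: H_def)
      then have S_le: "card (S I K g) \<le> card (H `` A)" using HA card_mono by blast
      have "A \<subseteq> E \<inter> I \<times> K" using A by (force simp: I_def K_def)
      then have "card A \<le> card (E \<inter> I \<times> K)" using finE by (intro card_mono) auto
      moreover have "card (E \<inter> I \<times> Y) = card (E \<inter> I \<times> K) + card (E \<inter> I \<times> (Y - K))"
        using sub finE by (subst card_Un_disjoint[symmetric]) (auto intro: arg_cong[where f = card])
      \<comment> \<open>For edges with ends in \<open>I\<close> and \<open>K\<close> the worst case
        is all of \<open>E \<inter> I \<times> K\<close>, and Hall's condition becomes this cut
        inequality. It follows from the row condition by bounding the minimum by \<open>g\<close> on
        \<open>K\<close> and by the edge count elsewhere.\<close>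
      moreover have "(\<Sum>i\<in>I. b i) \<le> (\<Sum>l\<in>K. g l) + card (E \<inter> I \<times> (Y - K))"
      proof -
        have "(\<Sum>i\<in>I. b i) \<le> (\<Sum>l\<in>Y. min (g l) (card {i \<in> I. (i, l) \<in> E}))"
          using rows sub by blast
        also have "\<dots> = (\<Sum>l\<in>K. min (g l) (card {i \<in> I. (i, l) \<in> E}))
            + (\<Sum>l\<in>Y - K. min (g l) (card {i \<in> I. (i, l) \<in> E}))"
          using sub fin by (simp add: sum.subset_diff)
        also have "\<dots> \<le> (\<Sum>l\<in>K. g l) + (\<Sum>l\<in>Y - K. card {i \<in> I. (i, l) \<in> E})"
          by (intro add_mono sum_mono) auto
        finally show ?thesis using finIK fin by (simp add: card_edges_between(2))
      qed
      ultimately show ?thesis using S_le card_S[OF sub, of g] by linarith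
    qed
    show "card B \<le> card (H\<inverse> `` B)" if B: "B \<subseteq> S R Y f" for B
    proof -
      define I K where "I = fst ` (Inl -` B)" and "K = fst ` (Inr -` B)"
      have sub: "I \<subseteq> R" "K \<subseteq> Y" using B by (auto simp: I_def K_def S_def)
      have finIK: "finite I" "finite K" using sub fin finite_subset by blast+
      have "B \<subseteq> S I K f"
      proof
        fix z assume z: "z \<in> B"
        then show "z \<in> S I K f" using B by (cases z) (force simp: S_def I_def K_def image_iff)+
      qed
      then have B_le: "card B \<le> card (S I K f)" using fin_S[OF sub] card_mono by blast
      \<comment> \<open>Slots of rows \<open>I\<close> and columns \<open>K\<close> can be filled by
        every edge that meets \<open>I\<close> or \<open>K\<close>. What remains to be shown is the
        dual cut inequality, from the column condition.\<close>
      have "E \<inter> I \<times> Y \<union> E \<inter> (R - I) \<times> K \<subseteq> H\<inverse> `` B"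
      proof
        fix e assume e: "e \<in> E \<inter> I \<times> Y \<union> E \<inter> (R - I) \<times> K"
        have "S R Y f \<subseteq> S R Y g" using fg by (force simp: S_def)
        then have B': "B \<subseteq> S R Y g" using B by blast
        from e consider p where "Inl p \<in> B" "fst p = fst e" | p where "Inr p \<in> B" "fst p = snd e"
          by (auto simp: I_def K_def)
        then show "e \<in> H\<inverse> `` B" using e B' by cases (auto simp: H_def intro!: ImageI)
      qed
      then have "card (E \<inter> I \<times> Y \<union> E \<inter> (R - I) \<times> K) \<le> card (H\<inverse> `` B)"
        by (rule card_mono[rotated]) (rule finite_subset[OF _ finE], auto simp: H_def)
      moreover have "card (E \<inter> I \<times> Y \<union> E \<inter> (R - I) \<times> K)
          = card (E \<inter> I \<times> Y) + card (E \<inter> (R - I) \<times> K)"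
        using finE by (intro card_Un_disjoint) auto
      moreover have "(\<Sum>l\<in>K. f l) \<le> (\<Sum>i\<in>I. b i) + card (E \<inter> (R - I) \<times> K)"
      proof -
        have "(\<Sum>l\<in>K. f l) \<le> (\<Sum>i\<in>R. min (b i) (card {l \<in> K. (i, l) \<in> E}))"
          using cols sub by blast
        also have "\<dots> = (\<Sum>i\<in>I. min (b i) (card {l \<in> K. (i, l) \<in> E}))
            + (\<Sum>i\<in>R - I. min (b i) (card {l \<in> K. (i, l) \<in> E}))"
          using sub fin by (simp add: sum.subset_diff)
        also have "\<dots> \<le> (\<Sum>i\<in>I. b i) + (\<Sum>i\<in>R - I. card {l \<in> K. (i, l) \<in> E})"
          by (intro add_mono sum_mono) auto
        finally show ?thesis using finIK fin by (simp add: card_edges_between(1))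
      qed
      ultimately show ?thesis using B_le card_S[OF sub, of f] by linarith
    qed
  qed (use fin_S finE in \<open>auto simp: H_def\<close>)
  define F where "F = {e \<in> E. h e \<in> range Inr}"
  \<comment> \<open>All rejection slots of row \<open>i\<close> belong to \<open>S R Y f\<close> and
    are therefore used, so exactly \<open>\<mu> i - b i\<close> of its edges are rejected and
    \<open>b i\<close> are left.\<close>
  have F: "card {l. (i, l) \<in> F} = b i" if i: "i \<in> R" for i
  proof -
    define D where "D = {e \<in> E. fst e = i \<and> h e \<in> range Inl}"
    have "h ` D = Inl ` ({i} \<times> {..<\<mu> i - b i})"
    proof
      show "h ` D \<subseteq> Inl ` ({i} \<times> {..<\<mu> i - b i})"
        using h(2) by (fastforce simp: D_def H_def S_def)
      show "Inl ` ({i} \<times> {..<\<mu> i - b i}) \<subseteq> h ` D"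
      proof
        fix z :: "'a \<times> nat + 'b \<times> nat"
        assume z: "z \<in> Inl ` ({i} \<times> {..<\<mu> i - b i})"
        then have "z \<in> S R Y f" using i by (auto simp: S_def)
        then obtain e where e: "e \<in> E" "z = h e" using h(3) by blast
        then have "fst e = i" using h(2)[OF e(1)] z by (auto simp: H_def)
        then show "z \<in> h ` D" using e z by (auto simp: D_def)
      qed
    qed
    moreover have "inj_on h D" using h(1) by (rule inj_on_subset) (auto simp: D_def)
    ultimately have "card D = card (Inl ` ({i} \<times> {..<\<mu> i - b i}) :: ('a \<times> nat + 'b \<times> nat) set)"
      by (metis card_image)
    then have cD: "card D = \<mu> i - b i" by (simp add: card_image)
    have "z \<in> range Inl \<longleftrightarrow> z \<notin> range Inr" for z :: "'a \<times> nat + 'b \<times> nat"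
      by (cases z) auto
    then have "D = {e \<in> E - F. fst e = i}" by (auto simp: D_def F_def)
    also have "\<dots> = Pair i ` {l. (i, l) \<in> E - F}" by force
    finally have "D = Pair i ` {l. (i, l) \<in> E - F}" .
    then have cD': "card {l. (i, l) \<in> E - F} = \<mu> i - b i"
      using cD by (simp add: card_image inj_on_def)
    have "{l \<in> Y. (i, l) \<in> E} = {l. (i, l) \<in> F} \<union> {l. (i, l) \<in> E - F}"
      using E by (auto simp: F_def)
    moreover have "finite {l. (i, l) \<in> F}" "finite {l. (i, l) \<in> E - F}"
      by (rule finite_subset[OF _ fin(2)], use E in \<open>auto simp: F_def\<close>)+
    then have "card ({l. (i, l) \<in> F} \<union> {l. (i, l) \<in> E - F})
        = card {l. (i, l) \<in> F} + card {l. (i, l) \<in> E - F}"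
      by (intro card_Un_disjoint) auto
    ultimately have "\<mu> i = card {l. (i, l) \<in> F} + (\<mu> i - b i)"
      using cD' by (simp add: \<mu>_def)
    then show ?thesis using b_le[OF i] by linarith
  qed
  \<comment> \<open>The accepted edges of column \<open>l\<close> occupy distinct slots among its
    \<open>g l\<close>, including the first \<open>f l\<close>.\<close>
  have G: "f l \<le> card {i. (i, l) \<in> F} \<and> card {i. (i, l) \<in> F} \<le> g l" if l: "l \<in> Y" for l
  proof -
    define D where "D = {e \<in> F. snd e = l}"
    have "D = (\<lambda>i. (i, l)) ` {i. (i, l) \<in> F}" by (auto simp: D_def)
    then have "card {i. (i, l) \<in> F} = card D" by (simp add: card_image inj_on_def)
    moreover have "card (h ` D) = card D"
      by (rule card_image, rule inj_on_subset[OF h(1)]) (auto simp: D_def F_def)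
    moreover have "h ` D \<subseteq> Inr ` ({l} \<times> {..<g l})"
      using h(2) by (fastforce simp: D_def F_def H_def S_def)
    then have "card (h ` D) \<le> card (Inr ` ({l} \<times> {..<g l}) :: ('a \<times> nat + 'b \<times> nat) set)"
      by (intro card_mono) auto
    moreover have "Inr ` ({l} \<times> {..<f l}) \<subseteq> h ` D"
    proof
      fix z :: "'a \<times> nat + 'b \<times> nat"
      assume z: "z \<in> Inr ` ({l} \<times> {..<f l})"
      then have "z \<in> S R Y f" using l by (auto simp: S_def)
      then obtain e where e: "e \<in> E" "z = h e" using h(3) by blast
      then have "snd e = l" using h(2)[OF e(1)] z by (auto simp: H_def)
      then show "z \<in> h ` D" using e z by (auto simp: D_def F_def)
    qed
    then have "card (Inr ` ({l} \<times> {..<f l}) :: ('a \<times> nat + 'b \<times> nat) set) \<le> card (h ` D)"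
      using finite_subset[OF _ finE, of D] by (intro card_mono) (auto simp: D_def F_def)
    ultimately show ?thesis by (simp add: card_image)
  qed
  show thesis by (rule that[OF _ F G]) (auto simp: F_def)
qed

section \<open>Unfolding an outline\<close>

text \<open>Symmetry makes the column condition a copy of the row condition, so an array enlarged by
  a row and its mirror column need only be checked row by row.\<close>

lemma symmetric_latin_array_iff:
  assumes "symmetric_array m A"
  shows "latin_array k m A \<longleftrightarrow> (\<forall>i\<in>{1..m}. A i ` {1..m} \<subseteq> {1..k} \<and> inj_on (A i) {1..m})"
proof
  assume lat: "latin_array k m A"
  show "\<forall>i\<in>{1..m}. A i ` {1..m} \<subseteq> {1..k} \<and> inj_on (A i) {1..m}"
  proof (intro ballI conjI inj_onI)
    fix i assume i: "i \<in> {1..m}"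
    show sub: "A i ` {1..m} \<subseteq> {1..k}" using lat i by (auto simp: latin_array_def)
    fix j j' assume j: "j \<in> {1..m}" "j' \<in> {1..m}" "A i j = A i j'"
    then have "card {j'' \<in> {1..m}. A i j'' = A i j} \<le> Suc 0"
      using lat i sub unfolding latin_array_def One_nat_def by blast
    then have "\<forall>x\<in>{j'' \<in> {1..m}. A i j'' = A i j}. \<forall>y\<in>{j'' \<in> {1..m}. A i j'' = A i j}. x = y"
      by (rule card_le_Suc0_iff_eq[THEN iffD1, rotated]) simp
    from this[THEN bspec, THEN bspec, of j j'] show "j = j'" using j by simp
  qed
next
  assume rows: "\<forall>i\<in>{1..m}. A i ` {1..m} \<subseteq> {1..k} \<and> inj_on (A i) {1..m}"
  have row: "card {j \<in> {1..m}. A i j = l} \<le> 1" if "i \<in> {1..m}" for i l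
  proof -
    have inj: "inj_on (A i) {1..m}" using rows that by blast
    have "\<forall>x\<in>{j \<in> {1..m}. A i j = l}. \<forall>y\<in>{j \<in> {1..m}. A i j = l}. x = y"
    proof (intro ballI)
      fix x y assume "x \<in> {j \<in> {1..m}. A i j = l}" "y \<in> {j \<in> {1..m}. A i j = l}"
      then show "x = y" using inj_onD[OF inj, of x y] by simp
    qed
    then show ?thesis unfolding One_nat_def
      by (rule card_le_Suc0_iff_eq[THEN iffD2, rotated]) simp
  qed
  have "{i \<in> {1..m}. A i j = l} = {i \<in> {1..m}. A j i = l}" if "j \<in> {1..m}" for j l
    using assms that by (auto simp: symmetric_array_def)
  moreover have "A i j \<in> {1..k}" if "i \<in> {1..m}" "j \<in> {1..m}" for i j using rows that by blast
  ultimately show "latin_array k m A" using row by (simp add: latin_array_def)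
qed

lemma occurrences_cong:
  assumes "top_left_subarray r L A"
  shows "occurrences r A l = occurrences r L l"
  using assms by (auto simp: occurrences_def top_left_subarray_def intro!: arg_cong[where f = card])

text \<open>Transposition exchanges the two off-diagonal blocks, whence the factor 2.\<close>

lemma occurrences_blocks:
  assumes "r \<le> n" "symmetric_array n A"
  shows "occurrences n A l = occurrences r A l
    + 2 * card {(i, j) \<in> {1..r} \<times> {r+1..n}. A i j = l} + card {(i, j) \<in> {r+1..n} \<times> {r+1..n}. A i j = l}"
proof -
  define B where "B = (\<lambda>I J. {(i, j) \<in> I \<times> J. A i j = l})"
  have fin: "finite (B I J)" if "finite I" "finite J" for I J
    by (rule finite_subset[of _ "I \<times> J"]) (use that in \<open>auto simp: B_def\<close>)
  have "B {r+1..n} {1..r} = prod.swap ` B {1..r} {r+1..n}"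
    using assms by (auto simp: B_def symmetric_array_def image_iff)
  then have swap: "card (B {r+1..n} {1..r}) = card (B {1..r} {r+1..n})"
    by (simp add: card_image)
  have "B {1..n} {1..n} = (B {1..r} {1..r} \<union> B {1..r} {r+1..n}) \<union> (B {r+1..n} {1..r} \<union> B {r+1..n} {r+1..n})"
    using assms(1) by (auto simp: B_def)
  also have "card \<dots> = card (B {1..r} {1..r} \<union> B {1..r} {r+1..n})
      + card (B {r+1..n} {1..r} \<union> B {r+1..n} {r+1..n})"
    by (rule card_Un_disjoint) (auto simp: fin, auto simp: B_def)
  also have "card (B {1..r} {1..r} \<union> B {1..r} {r+1..n}) = card (B {1..r} {1..r}) + card (B {1..r} {r+1..n})"
    by (rule card_Un_disjoint) (auto simp: fin, auto simp: B_def)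
  also have "card (B {r+1..n} {1..r} \<union> B {r+1..n} {r+1..n}) = card (B {r+1..n} {1..r}) + card (B {r+1..n} {r+1..n})"
    by (rule card_Un_disjoint) (auto simp: fin, auto simp: B_def)
  finally show ?thesis using swap by (simp add: occurrences_def B_def)
qed

lemma card_fiber_inj_on:
  assumes "inj_on h X"
  shows "card {x \<in> X. h x = l} = of_bool (l \<in> h ` X)"
proof (cases "l \<in> h ` X")
  case True
  then obtain x where "x \<in> X" "l = h x" by blast
  then have "{x \<in> X. h x = l} = {x}" using assms by (auto simp: inj_on_def)
  then show ?thesis using True by simp
next
  case False
  then have "{x \<in> X. h x = l} = {}" by blast
  then show ?thesis unfolding \<open>{x \<in> X. h x = l} = {}\<close> using False by simp
qed

text \<open>In an outline, S i is the set of symbols that row i receives in the m new columns, D l is the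
  number of new diagonal cells with symbol l, and p l the number of such cells strictly above the diagonal
  of the new block. Since each new row contains l at most once, l needs at least as many new rows
  as it has cells there. A row is split off by rounding the row that receives the fraction 1/m of
  everything; the symbols that are needed in all m new rows are tight, so the rounded row contains
  them and the condition survives with m - 1 in place of m.\<close>

lemma outline_completion:
  assumes "symmetric_array r A" "latin_array k r A"
    and "\<And>i. i \<in> {1..r} \<Longrightarrow> S i \<subseteq> {1..k} \<and> card (S i) = m \<and> (\<forall>j\<in>{1..r}. A i j \<notin> S i)"
    and "(\<Sum>l\<in>{1..k}. D l) = m" and "2 * (\<Sum>l\<in>{1..k}. p l) = m * (m - 1)"
    and "\<And>l. l \<in> {1..k} \<Longrightarrow> card {i \<in> {1..r}. l \<in> S i} + 2 * p l + D l \<le> m"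
  shows "\<exists>A'. symmetric_array (r + m) A' \<and> latin_array k (r + m) A' \<and> top_left_subarray r A A' \<and>
    (\<forall>l\<in>{1..k}. occurrences (r + m) A' l
        = occurrences r A l + 2 * card {i \<in> {1..r}. l \<in> S i} + 2 * p l + D l
      \<and> card {i \<in> {r+1..r+m}. A' i i = l} = D l)"
  using assms
proof (induction m arbitrary: r A S D p)
  case 0
  then show ?case by (intro exI[of _ A]) (simp add: top_left_subarray_def)
next
  case (Suc m)
  define X where "X = {1..r + Suc m}"
  define H where "H = {r+2..r + Suc m}"
  \<comment> \<open>Column \<open>x\<close> of the new row \<open>Suc r\<close> gets its average
    content, scaled by \<open>Suc m\<close>. Off the diagonal of the new block, \<open>l\<close> has
    \<open>2 * p l\<close> cells among \<open>Suc m * m\<close> places, which gives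
    \<open>2 * p l / m\<close> for each \<open>x\<close> in \<open>H\<close>.\<close>
  define w where "w = (\<lambda>x l. if x \<le> r then of_bool (l \<in> S x)
      else if x = Suc r then real (D l) else 2 * real (p l) / m)"
  have X: "X = insert (Suc r) ({1..r} \<union> H)" by (auto simp: X_def H_def)
  have S: "S i \<subseteq> {1..k}" "card (S i) = Suc m" if "i \<in> {1..r}" for i
    using Suc.prems(3) that by blast+
  have p_sum: "2 * (\<Sum>l\<in>{1..k}. p l) = Suc m * m" using Suc.prems(5) by simp
  have row: "(\<Sum>l\<in>{1..k}. w x l) = Suc m" if x: "x \<in> X" for x
  proof -
    consider "x \<in> {1..r}" | "x = Suc r" | "x \<in> H" using x X by blast
    then show ?thesis
    proof cases
      case 1
      then have "{1..k} \<inter> {l. l \<in> S x} = S x" using S by blast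
      then show ?thesis using S(2)[OF 1] 1 by (simp add: w_def)
    next
      case 2
      then show ?thesis using Suc.prems(4) by (simp add: w_def flip: of_nat_sum)
    next
      case 3
      then have "m > 0" by (auto simp: H_def)
      have "(\<Sum>l\<in>{1..k}. w x l) = real (2 * (\<Sum>l\<in>{1..k}. p l)) / m"
        using 3 by (simp add: w_def H_def sum_divide_distrib sum_distrib_left)
      also have "\<dots> = Suc m" using \<open>m > 0\<close> unfolding p_sum of_nat_mult by simp
      finally show ?thesis .
    qed
  qed
  have col: "(\<Sum>x\<in>X. w x l) = real (card {i \<in> {1..r}. l \<in> S i} + 2 * p l + D l)"
    if l: "l \<in> {1..k}" for l
  proof -
    have "(\<Sum>x\<in>{1..r}. w x l) = (\<Sum>x\<in>{1..r}. of_bool (l \<in> S x))"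
      by (rule sum.cong) (auto simp: w_def)
    also have "\<dots> = card {i \<in> {1..r}. l \<in> S i}" by (simp add: Int_def)
    finally have 1: "(\<Sum>x\<in>{1..r}. w x l) = card {i \<in> {1..r}. l \<in> S i}" .
    have "(\<Sum>x\<in>H. w x l) = (\<Sum>x\<in>H. 2 * real (p l) / m)"
      by (rule sum.cong) (auto simp: w_def H_def)
    also have "\<dots> = 2 * p l"
    \<comment> \<open>For \<open>m = 0\<close> the set \<open>H\<close> is empty, the quotient is 0
      by convention, and \<open>p_sum\<close> forces \<open>p l = 0\<close>.\<close>
    proof (cases "m = 0")
      case True
      then show ?thesis using p_sum l by simp
    qed (simp add: H_def)
    finally have 2: "(\<Sum>x\<in>H. w x l) = 2 * p l" .
    have "(\<Sum>x\<in>X. w x l) = w (Suc r) l + ((\<Sum>x\<in>{1..r}. w x l) + (\<Sum>x\<in>H. w x l))"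
      unfolding X by (subst sum.insert, (auto simp: H_def)[2], subst sum.union_disjoint) (auto simp: H_def)
    then show ?thesis unfolding 1 2 by (simp add: w_def)
  qed
  \<comment> \<open>\<open>h x\<close> is the symbol of the new row in column \<open>x\<close>;
    injectivity is the latin property of that row.\<close>
  obtain h where inj: "inj_on h X"
    and hw: "\<And>x. x \<in> X \<Longrightarrow> h x \<in> {1..k} \<and> w x (h x) > 0"
    and tight: "\<And>l. l \<in> {1..k} \<Longrightarrow> (\<Sum>x\<in>X. w x l) = real (Suc m) \<Longrightarrow> l \<in> h ` X"
  proof (rule matching_of_weights[of X "{1..k}" "real (Suc m)" w])
    show "(\<Sum>x\<in>X. w x l) \<le> real (Suc m)" if "l \<in> {1..k}" for l
      using Suc.prems(6)[OF that] col[OF that] by linarith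
  qed (use row in \<open>auto simp: X_def w_def\<close>)
  have h_S: "h x \<in> S x" if "x \<in> {1..r}" for x
    using hw[of x] that by (auto simp: X w_def split: if_splits)
  have h_D: "D (h (Suc r)) > 0" using hw[of "Suc r"] by (simp add: X w_def)
  have h_p: "p (h x) > 0" if "x \<in> H" for x
    using hw[of x] that by (auto simp: X w_def H_def zero_less_divide_iff split: if_splits)
  \<comment> \<open>These locate the at most one cell of \<open>l\<close> in the new row: in an old
    column, on the diagonal, or in a later column.\<close>
  define a b c :: "nat \<Rightarrow> nat" where "a = (\<lambda>l. card {i \<in> {1..r}. h i = l})"
    and "b = (\<lambda>l. of_bool (l = h (Suc r)))" and "c = (\<lambda>l. of_bool (l \<in> h ` H))"
  have abc: "a l + b l + c l = of_bool (l \<in> h ` X)" for l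
  proof -
    have inj': "inj_on h {1..r}" "inj_on h H" using inj by (auto simp: X intro: inj_on_subset)
    have "a l = of_bool (l \<in> h ` {1..r})" unfolding a_def by (rule card_fiber_inj_on[OF inj'(1)])
    moreover have "h ` {1..r} \<inter> h ` H = {}" "h (Suc r) \<notin> h ` {1..r} \<union> h ` H"
      using inj_on_image_Int[OF inj, of "{1..r}" H] inj_on_image_mem_iff[OF inj, of "Suc r" "{1..r} \<union> H"]
      by (auto simp: X H_def)
    ultimately show ?thesis by (auto simp: b_def c_def X)
  qed
  define A2 where "A2 = (\<lambda>i j. if i = Suc r then h j else if j = Suc r then h i else A i j)"
  \<comment> \<open>The symbols chosen for later columns are kept only as a set: they are what row
    \<open>Suc r\<close> still has to receive, and their order is left to the later rows.\<close>
  define S2 where "S2 = (\<lambda>i. if i = Suc r then h ` H else S i - {h i})"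
  have a_le: "card {i \<in> {1..r}. l \<in> S i} = card {i \<in> {1..r}. l \<in> S i - {h i}} + a l" for l
  proof -
    have "{i \<in> {1..r}. l \<in> S i} = {i \<in> {1..r}. l \<in> S i - {h i}} \<union> {i \<in> {1..r}. h i = l}"
      using h_S by auto
    then show ?thesis unfolding a_def by (simp add: card_Un_disjoint disjoint_iff)
  qed
  have S2_count: "card {i \<in> {1..Suc r}. l \<in> S2 i} + a l = card {i \<in> {1..r}. l \<in> S i} + c l" for l
  proof -
    have "{i \<in> {1..Suc r}. l \<in> S2 i} =
        {i \<in> {1..r}. l \<in> S i - {h i}} \<union> (if l \<in> h ` H then {Suc r} else {})"
      by (auto simp: S2_def le_Suc_eq)
    then show ?thesis unfolding a_le c_def by (auto simp: card_insert_if)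
  qed
  have b_le: "b l \<le> D l" and c_le: "c l \<le> p l" for l
    using h_D h_p by (auto simp: b_def c_def Suc_le_eq)
  have sym2: "symmetric_array (Suc r) A2"
    using Suc.prems(1) by (auto simp: symmetric_array_def A2_def le_Suc_eq)
  have tl2: "top_left_subarray r A A2" by (auto simp: top_left_subarray_def A2_def)
  have lat: "A i ` {1..r} \<subseteq> {1..k}" "inj_on (A i) {1..r}" if "i \<in> {1..r}" for i
    using Suc.prems(1,2) symmetric_latin_array_iff that by blast+
  have lat2: "latin_array k (Suc r) A2"
    unfolding symmetric_latin_array_iff[OF sym2]
  proof (intro ballI)
    fix i assume i: "i \<in> {1..Suc r}"
    show "A2 i ` {1..Suc r} \<subseteq> {1..k} \<and> inj_on (A2 i) {1..Suc r}"
    proof (cases "i = Suc r")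
      case True
      then have "A2 i = h" by (auto simp: A2_def)
      moreover have "{1..Suc r} \<subseteq> X" by (auto simp: X_def)
      ultimately show ?thesis using hw inj by (auto intro: inj_on_subset)
    next
      case False
      then have i: "i \<in> {1..r}" using i by auto
      have ins: "{1..Suc r} = insert (Suc r) {1..r}" by auto
      have eq: "A2 i j = A i j" if "j \<in> {1..r}" for j using i that by (auto simp: A2_def)
      have eq': "A2 i (Suc r) = h i" using False by (simp add: A2_def)
      have im: "A2 i ` {1..r} = A i ` {1..r}" using eq by (intro image_cong) auto
      have "h i \<notin> A i ` {1..r}" using Suc.prems(3)[OF i] h_S[OF i] by auto
      moreover have "inj_on (A2 i) {1..r} = inj_on (A i) {1..r}" by (rule inj_on_cong) (rule eq)
      then have "inj_on (A2 i) {1..r}" using lat(2)[OF i] by simp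
      moreover have "h i \<in> {1..k}" using hw i by (simp add: X)
      ultimately show ?thesis using lat(1)[OF i] unfolding ins by (simp add: im[unfolded One_nat_def] eq')
    qed
  qed
  have occ2: "occurrences (Suc r) A2 l = occurrences r A l + 2 * a l + b l" for l
  proof -
    have "{(i, j) \<in> {1..r} \<times> {r+1..Suc r}. A2 i j = l} = (\<lambda>i. (i, Suc r)) ` {i \<in> {1..r}. h i = l}"
      by (auto simp: A2_def)
    then have "card {(i, j) \<in> {1..r} \<times> {r+1..Suc r}. A2 i j = l} = a l"
      by (simp add: card_image inj_on_def a_def)
    moreover have "{(i, j) \<in> {r+1..Suc r} \<times> {r+1..Suc r}. A2 i j = l}
        = (if l = h (Suc r) then {(Suc r, Suc r)} else {})"
      by (auto simp: A2_def)
    ultimately show ?thesis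
      using occurrences_blocks[OF _ sym2, of r l] occurrences_cong[OF tl2] by (auto simp: b_def)
  qed
  have "\<exists>A'. symmetric_array (Suc r + m) A' \<and> latin_array k (Suc r + m) A' \<and> top_left_subarray (Suc r) A2 A' \<and>
    (\<forall>l\<in>{1..k}. occurrences (Suc r + m) A' l
        = occurrences (Suc r) A2 l + 2 * card {i \<in> {1..Suc r}. l \<in> S2 i} + 2 * (p l - c l) + (D l - b l)
      \<and> card {i \<in> {Suc r+1..Suc r+m}. A' i i = l} = D l - b l)"
  proof (rule Suc.IH[OF sym2 lat2])
    fix i assume i: "i \<in> {1..Suc r}"
    show "S2 i \<subseteq> {1..k} \<and> card (S2 i) = m \<and> (\<forall>j\<in>{1..Suc r}. A2 i j \<notin> S2 i)"
    proof (cases "i = Suc r")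
      case True
      have "card (h ` H) = m"
        using inj by (subst card_image) (auto simp: X H_def intro: inj_on_subset)
      moreover have "h j \<notin> h ` H" if "j \<in> {1..Suc r}" for j
        using that inj_on_image_mem_iff[OF inj, of j H] by (auto simp: X_def H_def)
      ultimately show ?thesis using True hw by (auto simp: S2_def A2_def X)
    next
      case False
      then have i: "i \<in> {1..r}" using i by auto
      have "finite (S i)" using S(1)[OF i] finite_subset by blast
      then show ?thesis
        using Suc.prems(3)[OF i] h_S[OF i] i by (auto simp: S2_def A2_def le_Suc_eq)
    qed
  next
    have "(\<Sum>l\<in>{1..k}. D l - b l) + (\<Sum>l\<in>{1..k}. b l) = Suc m"
      using Suc.prems(4) b_le by (simp add: sum.distrib[symmetric])
    moreover have "(\<Sum>l\<in>{1..k}. b l) = 1" using hw[of "Suc r"] by (simp add: b_def X of_bool_def)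
    ultimately show "(\<Sum>l\<in>{1..k}. D l - b l) = m" by simp
  next
    have "(\<Sum>l\<in>{1..k}. p l - c l) + (\<Sum>l\<in>{1..k}. c l) = (\<Sum>l\<in>{1..k}. p l)"
      using c_le by (simp add: sum.distrib[symmetric])
    moreover have "(\<Sum>l\<in>{1..k}. c l) = m"
    proof -
      have "h ` H \<subseteq> {1..k}" using hw unfolding X by blast
      then have "{1..k} \<inter> {l. l \<in> h ` H} = h ` H" by blast
      moreover have "card (h ` H) = m"
        using inj by (subst card_image) (auto simp: X H_def intro: inj_on_subset)
      ultimately show ?thesis by (simp add: c_def)
    qed
    ultimately show "2 * (\<Sum>l\<in>{1..k}. p l - c l) = m * (m - 1)"
      using p_sum by (cases m) (auto simp: algebra_simps)
  next
    fix l assume l: "l \<in> {1..k}"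
    \<comment> \<open>The left side loses \<open>a l + b l + c l\<close> in total, since a cell that
      leaves \<open>p\<close> with weight 2 returns with weight 1 in \<open>S2 (Suc r)\<close>. So
      it drops by 1 if \<open>l\<close> is in the new row, which is certain when the old bound was
      attained.\<close>
    have "card {i \<in> {1..r}. l \<in> S i} + 2 * p l + D l \<le> m + of_bool (l \<in> h ` X)"
      using Suc.prems(6)[OF l] tight[OF l] unfolding col[OF l] by (auto simp: le_Suc_eq)
    then show "card {i \<in> {1..Suc r}. l \<in> S2 i} + 2 * (p l - c l) + (D l - b l) \<le> m"
      using S2_count[of l] abc[of l] b_le[of l] c_le[of l] by linarith
  qed
  then obtain A' where A': "symmetric_array (Suc r + m) A'" "latin_array k (Suc r + m) A'"
    "top_left_subarray (Suc r) A2 A'"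
    and occ': "\<And>l. l \<in> {1..k} \<Longrightarrow> occurrences (Suc r + m) A' l
        = occurrences (Suc r) A2 l + 2 * card {i \<in> {1..Suc r}. l \<in> S2 i} + 2 * (p l - c l) + (D l - b l)"
    and diag': "\<And>l. l \<in> {1..k} \<Longrightarrow> card {i \<in> {Suc r+1..Suc r+m}. A' i i = l} = D l - b l"
    by blast
  have "top_left_subarray r A A'" using A'(3) tl2 by (auto simp: top_left_subarray_def)
  moreover have "occurrences (r + Suc m) A' l
        = occurrences r A l + 2 * card {i \<in> {1..r}. l \<in> S i} + 2 * p l + D l" if l: "l \<in> {1..k}" for l
    using occ'[OF l] occ2[of l] S2_count[of l] b_le[of l] c_le[of l] a_le[of l] by simp
  moreover have "card {i \<in> {r+1..r + Suc m}. A' i i = l} = D l" if l: "l \<in> {1..k}" for l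
  proof -
    have "A' (Suc r) (Suc r) = h (Suc r)" using A'(3) by (simp add: top_left_subarray_def A2_def)
    then have "{i \<in> {r+1..r + Suc m}. A' i i = l} = {i \<in> {Suc r+1..Suc r+m}. A' i i = l}
        \<union> (if l = h (Suc r) then {Suc r} else {})"
      by (auto simp: le_Suc_eq Suc_le_eq order_le_less)
    then show ?thesis using diag'[OF l] b_le[of l] by (auto simp: b_def card_insert_if)
  qed
  ultimately show ?case using A'(1,2) by (intro exI[of _ A']) simp
qed

section \<open>Sufficiency\<close>

lemma sum_card_fibers:
  assumes "finite X" "finite Y" "g ` X \<subseteq> Y"
  shows "(\<Sum>l\<in>Y. card {x \<in> X. g x = l}) = card X"
proof -
  have "card {l \<in> Y. g x = l} = 1" if "x \<in> X" for x
  proof -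
    have "{l \<in> Y. g x = l} = {g x}" using assms(3) that by auto
    then show ?thesis by simp
  qed
  then have "(\<Sum>l\<in>Y. card {x \<in> X. g x = l}) = (\<Sum>x\<in>X. 1)"
    using assms by (intro sum_multicount_gen) auto
  then show ?thesis by simp
qed

lemma sum_occurrences:
  assumes "latin_array k m A"
  shows "(\<Sum>l\<in>{1..k}. occurrences m A l) = m\<^sup>2"
proof -
  have "(\<Sum>l\<in>{1..k}. card {x \<in> {1..m} \<times> {1..m}. (\<lambda>(i, j). A i j) x = l}) = card ({1..m} \<times> {1..m})"
    by (rule sum_card_fibers) (use assms in \<open>auto simp: latin_array_def\<close>)
  moreover have "{x \<in> {1..m} \<times> {1..m}. (\<lambda>(i, j). A i j) x = l} = {(i, j) \<in> {1..m} \<times> {1..m}. A i j = l}" for l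
    by auto
  ultimately show ?thesis by (simp add: occurrences_def power2_eq_square)
qed

lemma exists_bounded_sum:
  fixes Z :: "'a \<Rightarrow> nat"
  assumes "finite Y" "t \<le> sum Z Y"
  shows "\<exists>z. (\<forall>l\<in>Y. z l \<le> Z l) \<and> sum z Y = t"
  using assms
proof (induction Y arbitrary: t rule: finite_induct)
  case (insert y Y t)
  have "t - min t (Z y) \<le> sum Z Y" using insert.prems insert.hyps by simp
  then obtain z where z: "\<forall>l\<in>Y. z l \<le> Z l" "sum z Y = t - min t (Z y)"
    using insert.IH by blast
  have "sum (z(y := min t (Z y))) Y = sum z Y" using insert.hyps by (intro sum.cong) auto
  then show ?case using z insert.hyps by (intro exI[of _ "z(y := min t (Z y))"]) auto
qed simp

lemma cong_mod_2_iff: "[x = y] (mod 2) \<longleftrightarrow> even x = even y" for x y :: int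
  unfolding cong_def by presburger

lemma odd_discrepancy_eq:
  "odd_discrepancy k \<rho> d r L
     = {l \<in> {1..k}. odd (int (\<rho> l) - int (occurrences r L l) - int (d l))}"
  by (simp add: odd_discrepancy_def cong_mod_2_iff)

lemma card_odd_discrepancy:
  "card (odd_discrepancy k \<rho> d r L)
     = (\<Sum>l\<in>{1..k}. of_bool (odd (int (\<rho> l) - int (occurrences r L l) - int (d l))))"
  by (simp add: odd_discrepancy_eq Int_def)

text \<open>The subgraph fixes the missing symbols of each row and the degree \<open>x\<close> of
  each symbol. This forces the number \<open>y\<close> of its cells in the new block, and only the
  division of \<open>y\<close> between the diagonal and the rest remains to be chosen.\<close>

lemma completion_exists:
  fixes n k r :: nat
  assumes "r \<le> n" and "(\<Sum>l\<in>{1..k}. \<rho> l) = n\<^sup>2"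
    and L: "rho_latin_rectangle k \<rho> r L" "symmetric_array r L"
    and adm: "admissible k \<rho> d r n L"
    and rows: "\<And>I. I \<subseteq> {1..r} \<Longrightarrow> (int n - int r) * int (card I)
              \<le> (\<Sum>l\<in>{1..k}. min ((int (\<rho> l) - int (occurrences r L l) - int (d l)) div 2)
                                     (int (mu_rows r L I l)))"
    and cols: "\<And>K. K \<subseteq> {1..k} \<Longrightarrow> (\<Sum>l\<in>K. max 0 (int (\<rho> l) - int (occurrences r L l) + int r - int n))
              \<le> (\<Sum>i\<in>{1..r}. min (int n - int r) (int (mu_symbols r L K i)))"
  shows "\<exists>L'. rho_latin_square k \<rho> n L' \<and> symmetric_array n L' \<and>
             top_left_subarray r L L' \<and> has_diagonal_tail k r n d L'"
proof -
  define m where "m = n - r"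
  define e where "e = occurrences r L"
  define a where "a = (\<lambda>l. \<rho> l - e l)"
  define Y where "Y = {1..k}"
  have n: "n = r + m" and int_m: "int n - int r = int m" using \<open>r \<le> n\<close> by (auto simp: m_def)
  have \<rho>: "\<rho> l = e l + a l" if "l \<in> Y" for l
    using L(1) that by (auto simp: rho_latin_rectangle_def a_def e_def Y_def)
  have lat: "latin_array k r L" using L(1) by (simp add: rho_latin_rectangle_def)
  have int_a: "int (\<rho> l) - int (occurrences r L l) = int (a l)" if "l \<in> Y" for l
    using \<rho>[OF that] by (simp add: e_def)
  \<comment> \<open>The row inequality for the empty set is not vacuous: \<open>mu_rows\<close> is 0
    there, so no floor on the right may be negative.\<close>
  have d_le: "d l \<le> a l" if l: "l \<in> Y" for l
  proof -
    have "0 \<le> (\<Sum>l\<in>Y. min ((int (\<rho> l) - int (occurrences r L l) - int (d l)) div 2) 0)"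
      using rows[of "{}"] by (simp add: mu_rows_def Y_def)
    also have "\<dots> = min ((int (\<rho> l) - int (occurrences r L l) - int (d l)) div 2) 0
        + (\<Sum>l\<in>Y - {l}. min ((int (\<rho> l) - int (occurrences r L l) - int (d l)) div 2) 0)"
      using l by (intro sum.remove) (auto simp: Y_def)
    also have "\<dots> \<le> min ((int (\<rho> l) - int (occurrences r L l) - int (d l)) div 2) 0 + 0"
      by (intro add_left_mono sum_nonpos) simp
    finally show ?thesis using int_a[OF l] by (simp split: if_splits add: min_def)
  qed
  have a_d: "a l + d l \<le> 2 * m" if "l \<in> Y" for l
    using adm int_a[OF that] that unfolding admissible_def int_m Y_def by fastforce
  define E where "E = {(i, l). i \<in> {1..r} \<and> l \<in> Y \<and> (\<forall>j\<in>{1..r}. L i j \<noteq> l)}"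
  obtain F where F: "F \<subseteq> E" "\<And>i. i \<in> {1..r} \<Longrightarrow> card {l. (i, l) \<in> F} = m"
    "\<And>l. l \<in> Y \<Longrightarrow> a l - m \<le> card {i. (i, l) \<in> F} \<and> card {i. (i, l) \<in> F} \<le> (a l - d l) div 2"
  \<comment> \<open>Truncated subtraction in \<open>a l - m\<close> is the maximum with 0 of the
    second inequality.\<close>
  proof (rule bipartite_degree_factor[of "{1..r}" Y E "\<lambda>l. a l - m" "\<lambda>l. (a l - d l) div 2" "\<lambda>_. m"])
    show "a l - m \<le> (a l - d l) div 2" if "l \<in> Y" for l using a_d[OF that] by linarith
    show "(\<Sum>i\<in>I. m) \<le> (\<Sum>l\<in>Y. min ((a l - d l) div 2) (card {i \<in> I. (i, l) \<in> E}))"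
      if I: "I \<subseteq> {1..r}" for I
    proof -
      have "min ((int (\<rho> l) - int (occurrences r L l) - int (d l)) div 2) (int (mu_rows r L I l))
          = int (min ((a l - d l) div 2) (card {i \<in> I. (i, l) \<in> E}))" if l: "l \<in> Y" for l
      proof -
        have "{i \<in> I. \<forall>j\<in>{1..r}. L i j \<noteq> l} = {i \<in> I. (i, l) \<in> E}" using I l by (auto simp: E_def)
        then show ?thesis
          using d_le[OF l] by (simp add: int_a[OF l] mu_rows_def of_nat_min zdiv_int of_nat_diff)
      qed
      then have "int (\<Sum>i\<in>I. m) \<le> int (\<Sum>l\<in>Y. min ((a l - d l) div 2) (card {i \<in> I. (i, l) \<in> E}))"
        using rows[OF I] by (simp add: int_m Y_def mult.commute del: of_nat_min)
      then show ?thesis by (simp only: of_nat_le_iff)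
    qed
    show "(\<Sum>l\<in>K. a l - m) \<le> (\<Sum>i\<in>{1..r}. min m (card {l \<in> K. (i, l) \<in> E}))"
      if K: "K \<subseteq> Y" for K
    proof -
      have "max 0 (int (\<rho> l) - int (occurrences r L l) + int r - int n) = int (a l - m)" if l: "l \<in> K" for l
        using int_a[of l] K l int_m by auto
      moreover have "min (int n - int r) (int (mu_symbols r L K i)) = int (min m (card {l \<in> K. (i, l) \<in> E}))"
        if i: "i \<in> {1..r}" for i
      proof -
        have "{l \<in> K. \<forall>j\<in>{1..r}. L i j \<noteq> l} = {l \<in> K. (i, l) \<in> E}" using K i by (auto simp: E_def)
        then show ?thesis by (simp add: int_m mu_symbols_def of_nat_min)
      qed
      ultimately have "int (\<Sum>l\<in>K. a l - m) \<le> int (\<Sum>i\<in>{1..r}. min m (card {l \<in> K. (i, l) \<in> E}))"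
        using cols[of K] K by (simp add: Y_def del: of_nat_min)
      then show ?thesis by (simp only: of_nat_le_iff)
    qed
    show "E \<subseteq> {1..r} \<times> Y" by (auto simp: E_def)
    show "finite {1..r}" "finite Y" by (simp_all add: Y_def)
  qed (rule that)
  define S where "S = (\<lambda>i. {l. (i, l) \<in> F})"
  define x where "x = (\<lambda>l. card {i \<in> {1..r}. l \<in> S i})"
  have x: "a l - m \<le> x l \<and> x l \<le> (a l - d l) div 2" if "l \<in> Y" for l
  proof -
    have "{i \<in> {1..r}. l \<in> S i} = {i. (i, l) \<in> F}" using F(1) by (auto simp: S_def E_def)
    then show ?thesis using F(3)[OF that] by (simp add: x_def)
  qed
  have S: "S i \<subseteq> {1..k} \<and> card (S i) = m \<and> (\<forall>j\<in>{1..r}. L i j \<notin> S i)" if "i \<in> {1..r}" for i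
    using F(1) F(2)[OF that] by (auto simp: S_def E_def Y_def)
  define y where "y = (\<lambda>l. a l - 2 * x l)"
  have y: "a l = y l + 2 * x l" "d l \<le> y l" "x l + y l \<le> m" if "l \<in> Y" for l
    using x[OF that] d_le[OF that] by (auto simp: y_def)
  have "(\<Sum>l\<in>Y. x l) = (\<Sum>i\<in>{1..r}. m)"
    unfolding x_def
  proof (rule sum_multicount_gen)
    show "\<forall>i\<in>{1..r}. card {l \<in> Y. l \<in> S i} = m"
    proof
      fix i assume "i \<in> {1..r}"
      then have S_i: "S i \<subseteq> Y" "card (S i) = m" using S by (simp_all add: Y_def)
      then have "{l \<in> Y. l \<in> S i} = S i" by blast
      then show "card {l \<in> Y. l \<in> S i} = m" using S_i(2) by simp
    qed
  qed (auto simp: Y_def)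
  then have sum_x: "(\<Sum>l\<in>Y. x l) = r * m" by simp
  have "n\<^sup>2 = (\<Sum>l\<in>Y. e l + (y l + 2 * x l))"
    using assms(2) \<rho> y(1) by (simp add: Y_def)
  also have "\<dots> = r\<^sup>2 + (\<Sum>l\<in>Y. y l) + 2 * (r * m)"
    using sum_occurrences[OF lat] by (simp add: sum.distrib sum_x flip: sum_distrib_left) (simp add: e_def Y_def)
  finally have sum_y: "(\<Sum>l\<in>Y. y l) = m * m"
    by (simp add: n power2_eq_square algebra_simps)
  \<comment> \<open>\<open>q\<close> is the extra diagonal cell forced by parity. Beyond
    \<open>d + q\<close> the cells of \<open>l\<close> form \<open>Z\<close> pairs: \<open>z\<close>
    of them go onto the diagonal, and each of the others becomes a cell above the diagonal with its
    mirror image.\<close>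
  define q where "q = (\<lambda>l. of_bool (odd (int (a l) - int (d l))) :: nat)"
  define Z where "Z = (\<lambda>l. (y l - d l - q l) div 2)"
  have Z: "y l = d l + q l + 2 * Z l" if "l \<in> Y" for l
  proof -
    have "q l \<le> y l - d l" "even (y l - d l - q l)"
      using y[OF that] by (auto simp: q_def elim: oddE) presburger+
    then show ?thesis using y(2)[OF that] by (simp add: Z_def)
  qed
  have card_q: "card (odd_discrepancy k \<rho> d r L) = (\<Sum>l\<in>Y. q l)"
    unfolding card_odd_discrepancy q_def using int_a by (intro sum.cong) (auto simp: Y_def)
  have dq_le: "(\<Sum>l\<in>Y. d l) + (\<Sum>l\<in>Y. q l) \<le> m"
    using adm unfolding admissible_def card_q int_m by (simp add: Y_def flip: of_nat_sum)
  have dq_even: "even (m - ((\<Sum>l\<in>Y. d l) + (\<Sum>l\<in>Y. q l)))"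
  proof -
    have "[int m - int (\<Sum>l\<in>Y. d l) = int (\<Sum>l\<in>Y. q l)] (mod 2)"
      using adm unfolding admissible_def card_q int_m by (auto simp: Y_def intro: cong_trans)
    then show ?thesis using dq_le unfolding cong_mod_2_iff by (auto simp del: of_nat_sum)
  qed
  define t where "t = (m - ((\<Sum>l\<in>Y. d l) + (\<Sum>l\<in>Y. q l))) div 2"
  have t: "m = (\<Sum>l\<in>Y. d l) + (\<Sum>l\<in>Y. q l) + 2 * t"
    using dq_even dq_le by (simp add: t_def)
  have sum_Z: "m * m = (\<Sum>l\<in>Y. d l) + (\<Sum>l\<in>Y. q l) + 2 * (\<Sum>l\<in>Y. Z l)"
    unfolding sum_y[symmetric] using Z by (simp add: sum.distrib sum_distrib_left)
  \<comment> \<open>\<open>2 * t\<close> and twice the sum of \<open>Z\<close> arise from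
    \<open>m\<close> and \<open>m * m\<close> by subtracting the same number, so there are enough
    pairs.\<close>
  have "m \<le> m * m" by simp
  then have "t \<le> (\<Sum>l\<in>Y. Z l)" using t sum_Z by linarith
  then obtain z where z: "\<And>l. l \<in> Y \<Longrightarrow> z l \<le> Z l" "(\<Sum>l\<in>Y. z l) = t"
    using exists_bounded_sum[of Y t Z] unfolding Y_def by blast
  define D where "D = (\<lambda>l. d l + q l + 2 * z l)"
  define p where "p = (\<lambda>l. Z l - z l)"
  have pD: "2 * p l + D l = y l" if "l \<in> Y" for l
    using Z[OF that] z(1)[OF that] by (simp add: p_def D_def)
  have sum_D: "(\<Sum>l\<in>Y. D l) = m"
    using z(2) t by (simp add: D_def sum.distrib flip: sum_distrib_left)
  have "2 * (\<Sum>l\<in>Y. p l) + m = m * m"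
  proof -
    have "(\<Sum>l\<in>Y. 2 * p l + D l) = m * m" using pD sum_y by simp
    then show ?thesis using sum_D by (simp add: sum.distrib sum_distrib_left)
  qed
  then have sum_p: "2 * (\<Sum>l\<in>Y. p l) = m * (m - 1)" by (simp add: diff_mult_distrib2)
  have "\<exists>L'. symmetric_array n L' \<and> latin_array k n L' \<and> top_left_subarray r L L' \<and>
    (\<forall>l\<in>{1..k}. occurrences n L' l = occurrences r L l + 2 * x l + 2 * p l + D l
      \<and> card {i \<in> {r+1..n}. L' i i = l} = D l)"
    unfolding n x_def
  proof (rule outline_completion[OF L(2) lat S])
    show "card {i \<in> {1..r}. l \<in> S i} + 2 * p l + D l \<le> m" if "l \<in> {1..k}" for l
      using y(3)[of l] pD[of l] that by (simp add: Y_def x_def)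
  qed (use sum_D sum_p in \<open>simp_all add: Y_def\<close>)
  then obtain L' where L': "symmetric_array n L'" "latin_array k n L'" "top_left_subarray r L L'"
    and occ: "\<And>l. l \<in> Y \<Longrightarrow> occurrences n L' l = e l + 2 * x l + 2 * p l + D l"
    and diag: "\<And>l. l \<in> Y \<Longrightarrow> card {i \<in> {r+1..n}. L' i i = l} = D l"
    unfolding e_def Y_def by blast
  have "occurrences n L' l = \<rho> l" if "l \<in> Y" for l
    using occ[OF that] pD[OF that] y(1)[OF that] \<rho>[OF that] by linarith
  then have "rho_latin_square k \<rho> n L'"
    unfolding rho_latin_square_def using L'(2) by (simp add: Y_def)
  moreover have "has_diagonal_tail k r n d L'"
    using diag by (simp add: has_diagonal_tail_def D_def Y_def)
  ultimately show ?thesis using L' by blast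
qed

section \<open>Necessity\<close>

text \<open>The cells to the right of L form the subgraph themselves, with incidences
  \<open>N\<close>. Everything is read off from \<rho> - e = 2x + y, x + y \<le> m, d \<le> D \<le>
  y and the evenness of y - D, where D counts diagonal cells.\<close>

lemma completion_conditions:
  fixes n k r :: nat
  assumes "r \<le> n" and A: "rho_latin_square k \<rho> n A" "symmetric_array n A"
    and tl: "top_left_subarray r L A" and tail: "has_diagonal_tail k r n d A"
  shows "admissible k \<rho> d r n L"
    and "I \<subseteq> {1..r} \<Longrightarrow> (int n - int r) * int (card I)
              \<le> (\<Sum>l\<in>{1..k}. min ((int (\<rho> l) - int (occurrences r L l) - int (d l)) div 2)
                                     (int (mu_rows r L I l)))"
    and "K \<subseteq> {1..k} \<Longrightarrow> (\<Sum>l\<in>K. max 0 (int (\<rho> l) - int (occurrences r L l) + int r - int n))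
              \<le> (\<Sum>i\<in>{1..r}. min (int n - int r) (int (mu_symbols r L K i)))"
proof -
  define m where "m = n - r"
  define T where "T = {r+1..n}"
  have int_m: "int n - int r = int m" and card_T: "card T = m" using \<open>r \<le> n\<close> by (auto simp: m_def T_def)
  have lat: "latin_array k n A" using A(1) by (simp add: rho_latin_square_def)
  have row_inj: "inj_on (A i) {1..n}" and ran: "A i ` {1..n} \<subseteq> {1..k}" if "i \<in> {1..n}" for i
    using lat that symmetric_latin_array_iff[OF A(2)] by blast+
  have le_n: "i \<in> {1..n}" if "i \<in> {1..r}" for i using that \<open>r \<le> n\<close> by auto
  have T_n: "T \<subseteq> {1..n}" by (auto simp: T_def)
  define N where "N = (\<lambda>i l. card {j \<in> T. A i j = l})"
  define x where "x = (\<lambda>l. \<Sum>i\<in>{1..r}. N i l)"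
  define y where "y = (\<lambda>l. \<Sum>i\<in>T. N i l)"
  define D where "D = (\<lambda>l. card {i \<in> T. A i i = l})"
  \<comment> \<open>A symbol already present in row \<open>i\<close> of \<open>L\<close> cannot
    recur in the new columns.\<close>
  have N_miss: "N i l \<le> of_bool (\<forall>j\<in>{1..r}. L i j \<noteq> l)" if i: "i \<in> {1..r}" for i l
  proof (cases "\<exists>j\<in>{1..r}. L i j = l")
    case True
    then obtain j where j: "j \<in> {1..r}" "A i j = l"
      using tl i by (auto simp: top_left_subarray_def)
    have "A i j' \<noteq> l" if "j' \<in> T" for j'
    proof
      assume "A i j' = l"
      then have "j' = j" using inj_onD[OF row_inj[OF le_n[OF i]], of j' j] j le_n that T_n by auto
      then show False using j(1) that by (simp add: T_def)
    qed
    then have "{j \<in> T. A i j = l} = {}" by blast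
    then show ?thesis unfolding N_def by (metis card.empty zero_le)
  next
    case False
    have "N i l = of_bool (l \<in> A i ` T)"
      unfolding N_def by (rule card_fiber_inj_on[OF inj_on_subset[OF row_inj[OF le_n[OF i]] T_n]])
    then show ?thesis using False by auto
  qed
  have N_sum: "(\<Sum>l\<in>{1..k}. N i l) = m" if "i \<in> {1..r}" for i
    unfolding N_def card_T[symmetric]
    by (rule sum_card_fibers) (use ran[OF le_n[OF that]] T_n in \<open>auto simp: T_def\<close>)
  have blocks: "\<rho> l = occurrences r L l + 2 * x l + y l" if "l \<in> {1..k}" for l
  proof -
    have cnt: "card {(i, j) \<in> I \<times> T. A i j = l} = (\<Sum>i\<in>I. N i l)" if "finite I" for I
    proof -
      have "{(i, j) \<in> I \<times> T. A i j = l} = {(i, j). A i j = l} \<inter> I \<times> T" by auto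
      then show ?thesis
        using card_edges_between(1)[OF that, of T "{(i, j). A i j = l}"] by (simp add: T_def N_def)
    qed
    have "card {(i, j) \<in> {1..r} \<times> T. A i j = l} = x l" unfolding x_def by (rule cnt) simp
    moreover have "card {(i, j) \<in> T \<times> T. A i j = l} = y l" unfolding y_def by (rule cnt) (simp add: T_def)
    moreover have "occurrences n A l = \<rho> l" using A(1) that by (simp add: rho_latin_square_def)
    ultimately show ?thesis
      using occurrences_blocks[OF \<open>r \<le> n\<close> A(2), of l] occurrences_cong[OF tl, of l] by (simp add: T_def)
  qed
  \<comment> \<open>Summed by columns instead of rows: each of the \<open>m\<close> new columns
    contains \<open>l\<close> at most once.\<close>
  have xy: "x l + y l \<le> m" if l: "l \<in> {1..k}" for l
  proof -
    have "{1..r} \<union> T = {1..n}" "{1..r} \<inter> T = {}" using \<open>r \<le> n\<close> by (auto simp: T_def)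
    then have "x l + y l = (\<Sum>i\<in>{1..n}. N i l)"
      unfolding x_def y_def by (subst sum.union_disjoint[symmetric]) (auto simp: T_def)
    also have "\<dots> = (\<Sum>j\<in>T. card {i \<in> {1..n}. A i j = l})"
      unfolding N_def by (rule sum_multicount_gen) (auto simp: T_def)
    also have "\<dots> \<le> (\<Sum>j\<in>T. 1)"
      using lat l T_n unfolding latin_array_def by (intro sum_mono) blast
    finally show ?thesis by (simp add: card_T)
  qed
  \<comment> \<open>The cells of \<open>l\<close> below the diagonal of the new block mirror those
    above it.\<close>
  have "\<exists>u. y l = D l + 2 * u" for l
  proof -
    define B where "B = (\<lambda>P. {(i, j) \<in> T \<times> T. A i j = l \<and> P i j})"
    have fin: "finite (B P)" for P
      by (rule finite_subset[of _ "T \<times> T"]) (auto simp: B_def T_def)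
    have "B (>) = prod.swap ` B (<)"
      using A(2) T_n by (fastforce simp: B_def symmetric_array_def image_iff subset_iff)
    then have 1: "card (B (>)) = card (B (<))" by (simp add: card_image)
    have "B (=) = (\<lambda>i. (i, i)) ` {i \<in> T. A i i = l}" by (auto simp: B_def)
    then have 2: "card (B (=)) = D l" by (simp add: D_def card_image inj_on_def)
    have "y l = card ({(i, j). A i j = l} \<inter> T \<times> T)"
      using card_edges_between(1)[of T T "{(i, j). A i j = l}"] by (simp add: T_def N_def y_def)
    also have "{(i, j). A i j = l} \<inter> T \<times> T = B (=) \<union> (B (<) \<union> B (>))" by (auto simp: B_def)
    also have "card \<dots> = card (B (=)) + card (B (<) \<union> B (>))"
      by (rule card_Un_disjoint) (auto simp: fin, auto simp: B_def)
    also have "card (B (<) \<union> B (>)) = card (B (<)) + card (B (>))"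
      by (rule card_Un_disjoint) (auto simp: fin, auto simp: B_def)
    finally show ?thesis using 1 2 by (intro exI[of _ "card (B (<))"]) simp
  qed
  then obtain u where u: "\<And>l. y l = D l + 2 * u l" by metis
  have sum_D: "(\<Sum>l\<in>{1..k}. D l) = m"
    unfolding D_def card_T[symmetric]
    by (rule sum_card_fibers) (use ran T_n in \<open>auto simp: T_def image_subset_iff\<close>)
  have d_D: "d l \<le> D l" if "l \<in> {1..k}" for l
    using tail that by (simp add: has_diagonal_tail_def D_def T_def)
  have int_a: "int (\<rho> l) - int (occurrences r L l) = int (2 * x l + y l)" if "l \<in> {1..k}" for l
    using blocks[OF that] by simp
  have odd_iff: "odd (int (\<rho> l) - int (occurrences r L l) - int (d l)) \<longleftrightarrow> odd (int (D l) - int (d l))"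
    if "l \<in> {1..k}" for l
    unfolding int_a[OF that] u by simp
  have sum_Dd: "int m - (\<Sum>l\<in>{1..k}. int (d l)) = (\<Sum>l\<in>{1..k}. int (D l) - int (d l))"
    unfolding sum_subtractf of_nat_sum[symmetric] sum_D by (rule refl)
  have card_odd: "int (card (odd_discrepancy k \<rho> d r L)) = (\<Sum>l\<in>{1..k}. of_bool (odd (int (D l) - int (d l))))"
    unfolding card_odd_discrepancy of_nat_sum by (intro sum.cong refl) (simp only: odd_iff of_nat_of_bool)
  \<comment> \<open>A sum is even iff the number of its odd terms is. Both sums in the congruences
    have terms with the parity of \<open>D l - d l\<close>.\<close>
  have even_card: "even (sum f {1..k}) \<longleftrightarrow> even (int (card (odd_discrepancy k \<rho> d r L)))"
    if "\<And>l. l \<in> {1..k} \<Longrightarrow> odd (f l) \<longleftrightarrow> odd (int (D l) - int (d l))" for f :: "nat \<Rightarrow> int"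
  proof -
    have "even (sum f {1..k}) \<longleftrightarrow> even (card {l \<in> {1..k}. odd (f l)})" by (rule even_sum_iff) simp
    also have "{l \<in> {1..k}. odd (f l)} = odd_discrepancy k \<rho> d r L"
      unfolding odd_discrepancy_eq using that odd_iff by blast
    finally show ?thesis by simp
  qed
  show "admissible k \<rho> d r n L"
    unfolding admissible_def int_m
  proof (intro conjI ballI)
    show "int (\<rho> l) - int (occurrences r L l) + int (d l) \<le> 2 * int m" if "l \<in> {1..k}" for l
      using int_a[OF that] xy[OF that] d_D[OF that] u[of l] by linarith
    \<comment> \<open>The nonnegative differences \<open>D l - d l\<close> add up to the right side,
      and each odd one is at least 1.\<close>
    show "int (card (odd_discrepancy k \<rho> d r L)) \<le> int m - (\<Sum>l\<in>{1..k}. int (d l))"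
      unfolding card_odd sum_Dd
    proof (rule sum_mono)
      show "of_bool (odd (int (D l) - int (d l))) \<le> int (D l) - int (d l)" if "l \<in> {1..k}" for l
        using d_D[OF that] by (cases "D l = d l") auto
    qed
    have "even (int m - (\<Sum>l\<in>{1..k}. int (d l))) \<longleftrightarrow> even (int (card (odd_discrepancy k \<rho> d r L)))"
      unfolding sum_Dd by (rule even_card) simp
    moreover have "even (\<Sum>l\<in>{1..k}. int (\<rho> l) - int (occurrences r L l) - int (d l))
        \<longleftrightarrow> even (int (card (odd_discrepancy k \<rho> d r L)))"
      by (rule even_card) (rule odd_iff)
    ultimately show "[int m - (\<Sum>l\<in>{1..k}. int (d l))
        = (\<Sum>l\<in>{1..k}. int (\<rho> l) - int (occurrences r L l) - int (d l))] (mod 2)"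
      "[(\<Sum>l\<in>{1..k}. int (\<rho> l) - int (occurrences r L l) - int (d l))
        = int (card (odd_discrepancy k \<rho> d r L))] (mod 2)"
      unfolding cong_mod_2_iff by simp_all
  qed
  show "(int n - int r) * int (card I)
        \<le> (\<Sum>l\<in>{1..k}. min ((int (\<rho> l) - int (occurrences r L l) - int (d l)) div 2) (int (mu_rows r L I l)))"
    if I: "I \<subseteq> {1..r}"
  proof -
    have finI: "finite I" using I finite_subset by blast
    have "(int n - int r) * int (card I) = int (\<Sum>i\<in>I. m)" by (simp add: int_m)
    also have "(\<Sum>i\<in>I. m) = (\<Sum>i\<in>I. \<Sum>l\<in>{1..k}. N i l)" using I N_sum by (intro sum.cong) auto
    also have "\<dots> = (\<Sum>l\<in>{1..k}. \<Sum>i\<in>I. N i l)" by (rule sum.swap)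
    also have "int \<dots>
          \<le> (\<Sum>l\<in>{1..k}. min ((int (\<rho> l) - int (occurrences r L l) - int (d l)) div 2) (int (mu_rows r L I l)))"
      unfolding of_nat_sum[where f = "\<lambda>l. \<Sum>i\<in>I. N i l"]
    proof (intro sum_mono min.boundedI)
      fix l assume l: "l \<in> {1..k}"
      \<comment> \<open>The floor is that of half of \<open>2 * x l + (y l - d l)\<close>, where
        \<open>d l \<le> y l\<close>; so it is at least \<open>x l\<close>.\<close>
      have "(\<Sum>i\<in>I. N i l) \<le> x l" unfolding x_def using I by (intro sum_mono2) auto
      then show "int (\<Sum>i\<in>I. N i l) \<le> (int (\<rho> l) - int (occurrences r L l) - int (d l)) div 2"
        using int_a[OF l] d_D[OF l] u[of l] by linarith
      have "(\<Sum>i\<in>I. N i l) \<le> (\<Sum>i\<in>I. of_bool (\<forall>j\<in>{1..r}. L i j \<noteq> l))"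
        using I by (intro sum_mono N_miss) blast
      also have "\<dots> = mu_rows r L I l" using finI by (simp add: mu_rows_def Int_def)
      finally show "int (\<Sum>i\<in>I. N i l) \<le> int (mu_rows r L I l)" by (simp only: of_nat_le_iff)
    qed
    finally show ?thesis .
  qed
  show "(\<Sum>l\<in>K. max 0 (int (\<rho> l) - int (occurrences r L l) + int r - int n))
        \<le> (\<Sum>i\<in>{1..r}. min (int n - int r) (int (mu_symbols r L K i)))"
    if K: "K \<subseteq> {1..k}"
  proof -
    have finK: "finite K" using K finite_subset by blast
    have "(\<Sum>l\<in>K. max 0 (int (\<rho> l) - int (occurrences r L l) + int r - int n)) \<le> (\<Sum>l\<in>K. int (x l))"
    proof (rule sum_mono)
      fix l assume "l \<in> K"
      then have l: "l \<in> {1..k}" using K by blast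
      \<comment> \<open>Subtracting \<open>x l\<close> from \<open>2 * x l + y l\<close> leaves
        \<open>x l + y l\<close>, which is at most \<open>m\<close>.\<close>
      show "max 0 (int (\<rho> l) - int (occurrences r L l) + int r - int n) \<le> int (x l)"
        using int_a[OF l] xy[OF l] int_m by linarith
    qed
    also have "\<dots> = int (\<Sum>i\<in>{1..r}. \<Sum>l\<in>K. N i l)"
      unfolding x_def of_nat_sum by (rule sum.swap)
    also have "\<dots> \<le> (\<Sum>i\<in>{1..r}. min (int n - int r) (int (mu_symbols r L K i)))"
      unfolding of_nat_sum[where f = "\<lambda>i. \<Sum>l\<in>K. N i l"]
    proof (intro sum_mono min.boundedI)
      fix i assume i: "i \<in> {1..r}"
      have "(\<Sum>l\<in>K. N i l) \<le> (\<Sum>l\<in>{1..k}. N i l)" using K by (intro sum_mono2) auto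
      then show "int (\<Sum>l\<in>K. N i l) \<le> int n - int r"
        unfolding int_m of_nat_le_iff N_sum[OF i] .
      have "(\<Sum>l\<in>K. N i l) \<le> (\<Sum>l\<in>K. of_bool (\<forall>j\<in>{1..r}. L i j \<noteq> l))"
        using N_miss[OF i] by (intro sum_mono)
      also have "\<dots> = mu_symbols r L K i" using finK by (simp add: mu_symbols_def Int_def)
      finally show "int (\<Sum>l\<in>K. N i l) \<le> int (mu_symbols r L K i)" by (simp only: of_nat_le_iff)
    qed
    finally show ?thesis .
  qed
qed

section \<open>The completion theorem\<close>

theorem mainTheorem2:
  fixes n k r :: nat
    and \<rho> d e :: "nat \<Rightarrow> nat"
    and L :: "nat \<Rightarrow> nat \<Rightarrow> nat"
  assumes "n > 0" and "k > 0" and "r < n"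
    and "\<And>l. l \<in> {1..k} \<Longrightarrow> 1 \<le> \<rho> l \<and> \<rho> l \<le> n" and "n \<le> k"
    and "(\<Sum>l\<in>{1..k}. \<rho> l) = n\<^sup>2"
    and "(\<Sum>l\<in>{1..k}. d l) \<le> n - r"
    and "rho_latin_rectangle k \<rho> r L" and "symmetric_array r L"
    and "\<And>l. l \<in> {1..k} \<Longrightarrow> e l = occurrences r L l"
  shows "(\<exists>L'. rho_latin_square k \<rho> n L' \<and> symmetric_array n L' \<and>
             top_left_subarray r L L' \<and> has_diagonal_tail k r n d L')
     \<longleftrightarrow>
         admissible k \<rho> d r n L \<and>
         (\<forall>I. I \<subseteq> {1..r} \<longrightarrow>
            (int n - int r) * int (card I)
              \<le> (\<Sum>l\<in>{1..k}. min ((int (\<rho> l) - int (e l) - int (d l)) div 2)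
                                     (int (mu_rows r L I l)))) \<and>
         (\<forall>K. K \<subseteq> {1..k} \<longrightarrow>
            (\<Sum>l\<in>K. max 0 (int (\<rho> l) - int (e l) + int r - int n))
              \<le> (\<Sum>i\<in>{1..r}. min (int n - int r) (int (mu_symbols r L K i))))"
proof -
  have e: "(\<Sum>l\<in>{1..k}. min ((int (\<rho> l) - int (e l) - int (d l)) div 2) (int (mu_rows r L I l)))
      = (\<Sum>l\<in>{1..k}. min ((int (\<rho> l) - int (occurrences r L l) - int (d l)) div 2) (int (mu_rows r L I l)))"
    "K \<subseteq> {1..k} \<Longrightarrow> (\<Sum>l\<in>K. max 0 (int (\<rho> l) - int (e l) + int r - int n))
      = (\<Sum>l\<in>K. max 0 (int (\<rho> l) - int (occurrences r L l) + int r - int n))" for I K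
    by (rule sum.cong; use assms(10) in auto)+
  show ?thesis
  proof (intro iffI conjI allI impI; (elim exE conjE)?)
    fix L' assume "rho_latin_square k \<rho> n L'" "symmetric_array n L'"
      "top_left_subarray r L L'" "has_diagonal_tail k r n d L'"
    note conds = completion_conditions[OF less_imp_le[OF \<open>r < n\<close>] this]
    show "admissible k \<rho> d r n L" by (rule conds(1))
    show "(int n - int r) * int (card I)
          \<le> (\<Sum>l\<in>{1..k}. min ((int (\<rho> l) - int (e l) - int (d l)) div 2) (int (mu_rows r L I l)))"
      if "I \<subseteq> {1..r}" for I
      unfolding e(1) by (rule conds(2)[OF that])
    show "(\<Sum>l\<in>K. max 0 (int (\<rho> l) - int (e l) + int r - int n))
          \<le> (\<Sum>i\<in>{1..r}. min (int n - int r) (int (mu_symbols r L K i)))"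
      if "K \<subseteq> {1..k}" for K
      unfolding e(2)[OF that] by (rule conds(3)[OF that])
  next
    assume adm: "admissible k \<rho> d r n L"
      and rows: "\<forall>I. I \<subseteq> {1..r} \<longrightarrow> (int n - int r) * int (card I)
        \<le> (\<Sum>l\<in>{1..k}. min ((int (\<rho> l) - int (e l) - int (d l)) div 2) (int (mu_rows r L I l)))"
      and cols: "\<forall>K. K \<subseteq> {1..k} \<longrightarrow> (\<Sum>l\<in>K. max 0 (int (\<rho> l) - int (e l) + int r - int n))
        \<le> (\<Sum>i\<in>{1..r}. min (int n - int r) (int (mu_symbols r L K i)))"
    show "\<exists>L'. rho_latin_square k \<rho> n L' \<and> symmetric_array n L' \<and>
             top_left_subarray r L L' \<and> has_diagonal_tail k r n d L'"
    proof (rule completion_exists[OF less_imp_le[OF \<open>r < n\<close>] assms(6,8,9) adm])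
      fix I assume I: "I \<subseteq> {1..r}"
      show "(int n - int r) * int (card I)
          \<le> (\<Sum>l\<in>{1..k}. min ((int (\<rho> l) - int (occurrences r L l) - int (d l)) div 2) (int (mu_rows r L I l)))"
        using rows[rule_format, OF I] unfolding e(1) .
    next
      fix K assume K: "K \<subseteq> {1..k}"
      show "(\<Sum>l\<in>K. max 0 (int (\<rho> l) - int (occurrences r L l) + int r - int n))
          \<le> (\<Sum>i\<in>{1..r}. min (int n - int r) (int (mu_symbols r L K i)))"
        using cols[rule_format, OF K] unfolding e(2)[OF K] .
    qed
  qed
qed

end
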